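(* For every $i=1,\dots,n$ and $t\in\mathbb{T}_n$, in $\mathbb{S}/{\sim}$ we have $$[y_{i;t}^\mathrm{g}]=\left[\prod_{l=1}^{r_i}y_{il;t}^{\mathrm{c}}\right]^{\frac{1}{r_i}},$$ where the right hand side is the unique $r_i$-th root of $\left[\prod_{l=1}^{r_i}y_{il;t}^{\mathrm{c}}\right]$ in $\mathbb{S}/{\sim}$.
   Context: Notation: $[a]_+=\max(a,0)$. A semifield $(\mathbb{P},\oplus,\cdot)$ is a multiplicative abelian group with a commutative associative addition $\oplus$ over which multiplication distributes; $\mathbb{P}_0=\mathbb{P}\sqcup\{0\}$ with $0\oplus p=p$, $0\cdot p=0$. $\mathbb{ZP}$ is the group ring of $(\mathbb{P},\cdot)$ (an integral domain), $\mathbb{QP}$ its fraction field, $\mathbb{NP}\subset\mathbb{ZP}$ the elements with nonnegative coefficients, and $\pi_{\mathbb{P}_0}:\mathbb{NP}\to\mathbb{P}_0$, $\sum_j a_jp_j\mapsto\bigoplus_j (p_j\oplus\cdots\oplus p_j)$ ($a_j$ terms). Generalized $Y$-pattern. Fix $n\ge1$, ${\bf r}=(r_1,\dots,r_n)\in\mathbb{Z}_{\ge1}^n$, a semifield $\mathbb{P}$. A generalized $Y$-seed is $({\bf y},{\bf Z},B)$ with ${\bf y}\in\mathbb{P}^n$, ${\bf Z}=(Z_1(u),\dots,Z_n(u))$, $Z_i(u)=\sum_{l=0}^{r_i}\hat z_{il}u^l$, $\hat z_{il}\in\mathbb{NP}$, $\hat z_{i0}=\hat z_{ir_i}=1$,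 and $B=(b_{ij})$ a skew-symmetrizable integer $n\times n$ matrix. Put $Z_k|_{\mathbb{P}_0}(y)=\bigoplus_l\pi_{\mathbb{P}_0}(\hat z_{kl})y^l$. Its mutation in direction $k$: $y_k'=y_k^{-1}$, $y_i'=y_i(y_k^{[b_{ki}]_+})^{r_k}Z_k|_{\mathbb{P}_0}(y_k)^{-b_{ki}}$ ($i\neq k$); $Z_k'(u)=u^{r_k}Z_k(u^{-1})$, $Z_i'=Z_i$ ($i\ne k$); $b'_{ij}=-b_{ij}$ if $i=k$ or $j=k$, else $b'_{ij}=b_{ij}+r_k(b_{ik}[b_{kj}]_++[-b_{ik}]_+b_{kj})$. The case ${\bf r}=(1,\dots,1)$, $Z_i(u)=1+u$ gives ordinary $Y$-seeds $({\bf y},B)$ and ordinary mutations. $\mathbb{T}_n$ is the $n$-regular tree with edges labeled $1,\dots,n$ (the $n$ edges at each vertex having distinct labels); vertices joined by an edge labeled $k$ are $k$-adjacent; $t_0$ is a fixed vertex. Let $\{({\bf y}^{\mathrm{g}}_t,{\bf Z}_t,B_t)\}_{t\in\mathbb{T}_n}$ be any generalized $Y$-pattern, i.e. a family of generalized $Y$-seeds such that seeds at $k$-adjacent vertices are related by mutation in direction $k$. Let ${\bf Z}=(Z_i(u)=\sum_l\hat z_{il}u^l)$ be the exchange polynomials at $t_0$ and $z_{il}=\pi_{\mathbb{P}_0}(\hat z_{il})$. Extended semifield. Let $\mathcal{D}=\{(i,l)\mid 1\le i\le n,\ 1\le l\le r_i\}$, ${\bf s}=\{s_{il}\}_{(i,l)\in\mathcal{D}}$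 formal variables, and $\overline{\mathbb{P}}=\{f/g\in\mathbb{QP}({\bf s})\mid f,g\in\mathbb{NP}[{\bf s}]\setminus\{0\}\}$, a semifield under addition (denoted $\bar\oplus$) and multiplication of fractions. Let $e_{il}\in\overline{\mathbb{P}}$ be the degree-$l$ elementary symmetric polynomial in $s_{i1},\dots,s_{ir_i}$ with respect to $\bar\oplus$, ${\bf e}=\{e_{il}\}_{(i,l)\in\mathcal{D}}$, and $\psi:\mathbb{NP}[{\bf e}]\to\mathbb{P}_0$ the additive and multiplicative homomorphism extending $\pi_{\mathbb{P}_0}$ with $\psi(e_{il})=z_{il}$. Let $\mathbb{S}=\{f/g\in\overline{\mathbb{P}}\mid f,g\in\mathbb{NP}[{\bf e}],\ \psi(f),\psi(g)\ne0\}$, a subsemifield of $\overline{\mathbb{P}}$ containing $\mathbb{P}$ (via $p=p/1$); $\psi$ extends to a semifield homomorphism $\psi:\mathbb{S}\to\mathbb{P}$, $\psi(f/g)=\psi(f)/\psi(g)$. Write $f\sim g$ iff $\psi(f)=\psi(g)$ ($f,g\in\mathbb{S}$), and $[f]$ for the class of $f$ in $\mathbb{S}/{\sim}$. Composite $Y$-pattern. Let $\mathcal{B}_{t_0}$ be the $\mathcal{D}\times\mathcal{D}$ matrix whose $((i,l),(j,m))$ entry is $b_{ij;t_0}$, and consider the ordinary $Y$-seed $({\bf y}^{\mathrm{c}}_{t_0},\mathcal{B}_{t_0})$, indexed by $\mathcal{D}$ and with coefficients in $\overline{\mathbb{P}}$, where $y^{\mathrm{c}}_{il;t_0}=s_{il}y^{\mathrm{g}}_{i;t_0}$.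 With $\mu_{il}$ the ordinary mutation in direction $(i,l)$, set $\mu^{\mathrm{c}}_k=\mu_{kr_k}\circ\cdots\circ\mu_{k1}$. The composite $Y$-pattern $\{({\bf y}^{\mathrm{c}}_t,\mathcal{B}_t)\}_{t\in\mathbb{T}_n}$ is determined by this initial $Y$-seed and $({\bf y}^{\mathrm{c}}_{t'},\mathcal{B}_{t'})=\mu^{\mathrm{c}}_k({\bf y}^{\mathrm{c}}_t,\mathcal{B}_t)$ for $k$-adjacent $t,t'$. The products $\prod_{l=1}^{r_i}y^{\mathrm{c}}_{il;t}$ belong to $\mathbb{S}$. *)

theory Defs
  imports
    "HOL-Library.Poly_Mapping"
    "HOL-Library.Product_Lexorder"
    "HOL-Library.FuncSet"
    "HOL-Computational_Algebra.Polynomial"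
    "HOL-Computational_Algebra.Fraction_Field"
    "HOL-Algebra.Group"
begin

section \<open>Semifields\<close>

text \<open>\<open>comm_semiring\<close> has no zero element and \<open>comm_monoid_mult\<close> supplies the unit, so the
  two axioms below make the multiplicative structure an abelian group.\<close>

class semifield = comm_semiring + comm_monoid_mult + inverse +
  assumes semifield_left_inverse: "inverse a * a = 1"
    and semifield_divide_inverse: "a / b = a * inverse b"

datatype 'p adjoin_zero = Zero | Elt (unElt: 'p)

instantiation adjoin_zero :: (semifield) comm_semiring_1
begin

definition zero_adjoin_zero :: "'a adjoin_zero" where "0 = Zero"

definition one_adjoin_zero :: "'a adjoin_zero" where "1 = Elt 1"

fun plus_adjoin_zero :: "'a adjoin_zero \<Rightarrow> 'a adjoin_zero \<Rightarrow> 'a adjoin_zero" where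
  "Zero + q = q"
| "Elt p + Zero = Elt p"
| "Elt p + Elt q = Elt (p + q)"

fun times_adjoin_zero :: "'a adjoin_zero \<Rightarrow> 'a adjoin_zero \<Rightarrow> 'a adjoin_zero" where
  "Zero * q = Zero"
| "Elt p * Zero = Zero"
| "Elt p * Elt q = Elt (p * q)"

instance
proof
  fix a b c :: "'a adjoin_zero"
  show "a + b + c = a + (b + c)" by (cases a; cases b; cases c) (auto simp: add.assoc)
  show "a + b = b + a" by (cases a; cases b) (auto simp: add.commute)
  show "0 + a = a" by (simp add: zero_adjoin_zero_def)
  show "a * b * c = a * (b * c)" by (cases a; cases b; cases c) (auto simp: mult.assoc)
  show "a * b = b * a" by (cases a; cases b) (auto simp: mult.commute)
  show "1 * a = a" by (cases a) (auto simp: one_adjoin_zero_def)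
  show "0 * a = 0" by (simp add: zero_adjoin_zero_def)
  show "a * 0 = 0" by (cases a) (auto simp: zero_adjoin_zero_def)
  show "(a + b) * c = a * c + b * c"
    by (cases a; cases b; cases c) (auto simp: distrib_right)
  show "(0 :: 'a adjoin_zero) \<noteq> 1" by (simp add: zero_adjoin_zero_def one_adjoin_zero_def)
qed

end


section \<open>The multiplicative group of a semifield is orderable\<close>

text \<open>Semifields are torsion-free as multiplicative groups, hence admit a (non-canonical)
  linear group order. The order serves only to obtain, through the library instances for
  \<open>poly_mapping\<close>, that the group ring is an integral domain; nothing below depends on
  which order is chosen.\<close>

primrec geo :: "'p::semifield \<Rightarrow> nat \<Rightarrow> 'p" where
  "geo p 0 = 1"
| "geo p (Suc k) = 1 + p * geo p k"

lemma geo_Suc': "geo p (Suc k) = geo p k + p ^ Suc k"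
proof (induction k)
  case 0
  show ?case by simp
next
  case (Suc k)
  have "geo p (Suc (Suc k)) = 1 + p * geo p (Suc k)" by simp
  also have "\<dots> = 1 + p * (geo p k + p ^ Suc k)" by (simp only: Suc.IH)
  also have "\<dots> = geo p (Suc k) + p ^ Suc (Suc k)" by (simp add: distrib_left add.assoc)
  finally show ?case .
qed

lemma semifield_right_inverse: "a * inverse a = (1 :: 'p::semifield)"
  by (metis mult.commute semifield_left_inverse)

lemma semifield_cancel:
  fixes a b c :: "'p::semifield"
  assumes "a * c = b * c"
  shows "a = b"
proof -
  have "a = (a * c) * inverse c"
    by (simp add: mult.assoc semifield_right_inverse)
  also have "\<dots> = b"
    by (simp add: assms mult.assoc semifield_right_inverse)
  finally show ?thesis .
qed

lemma semifield_torsion_free: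
  fixes p :: "'p::semifield"
  assumes "p ^ n = 1" and "n > 0"
  shows "p = 1"
proof -
  obtain k where n: "n = Suc k" using assms(2) by (cases n) auto
  show ?thesis
  proof (cases k)
    case 0
    then show ?thesis using assms(1) n by simp
  next
    case (Suc j)
    have "p * geo p k = p * geo p j + p ^ n"
      unfolding Suc n geo_Suc' by (simp add: distrib_left)
    also have "\<dots> = geo p k"
      using assms(1) by (simp add: Suc add.commute)
    finally have "p * geo p k = 1 * geo p k" by simp
    then show ?thesis by (rule semifield_cancel)
  qed
qed

definition is_cone :: "'p::semifield set \<Rightarrow> bool" where
  "is_cone M \<longleftrightarrow> 1 \<in> M \<and> (\<forall>x\<in>M. \<forall>y\<in>M. x * y \<in> M) \<and> (\<forall>x\<in>M. inverse x \<in> M \<longrightarrow> x = 1)"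

lemma semifield_inverse_unique: "x * y = 1 \<Longrightarrow> inverse x = (y :: 'p::semifield)"
proof -
  assume "x * y = 1"
  then have "y * x = inverse x * x" by (simp add: mult.commute[of y] semifield_left_inverse)
  then have "y = inverse x" by (rule semifield_cancel)
  then show ?thesis ..
qed

lemma semifield_inverse_power: "inverse (x ^ n) = (inverse x ^ n :: 'p::semifield)"
  by (rule semifield_inverse_unique)
    (simp add: power_mult_distrib[symmetric] semifield_right_inverse)

lemma semifield_inverse_inverse: "inverse (inverse x) = (x :: 'p::semifield)"
  by (rule semifield_inverse_unique, rule semifield_left_inverse)

lemma semifield_mult_inverse_cancel: "a * (inverse a * b) = (b :: 'p::semifield)"
  by (simp add: mult.assoc[symmetric] semifield_right_inverse)

lemma semifield_inverse_mult: "inverse (a * b) = (inverse a * inverse b :: 'p::semifield)"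
proof (rule semifield_inverse_unique)
  have "a * b * (inverse a * inverse b) = (a * inverse a) * (b * inverse b)"
    by (simp only: ac_simps)
  then show "a * b * (inverse a * inverse b) = 1" by (simp add: semifield_right_inverse)
qed

lemma cone_power: "is_cone M \<Longrightarrow> x \<in> M \<Longrightarrow> x ^ n \<in> M"
  by (induction n) (auto simp: is_cone_def)

lemma cone_extend:
  fixes g :: "'p::semifield"
  assumes M: "is_cone M" and max: "\<forall>X. is_cone X \<longrightarrow> M \<subseteq> X \<longrightarrow> X = M" and g: "g \<notin> M"
  shows "\<exists>k>0. inverse g ^ k \<in> M"
proof (rule ccontr)
  assume neg: "\<not> (\<exists>k>0. inverse g ^ k \<in> M)"
  define N where "N = {m * g ^ k | m k. m \<in> M}"
  have one: "1 \<in> M" and mult: "\<And>x y. x \<in> M \<Longrightarrow> y \<in> M \<Longrightarrow> x * y \<in> M"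
    and inv: "\<And>x. x \<in> M \<Longrightarrow> inverse x \<in> M \<Longrightarrow> x = 1"
    using M by (auto simp: is_cone_def)
  have MN: "M \<subseteq> N"
  proof
    fix m assume "m \<in> M"
    then show "m \<in> N" unfolding N_def by (auto intro!: exI[of _ m] exI[of _ "0::nat"])
  qed
  have gN: "g \<in> N"
    unfolding N_def using one by (auto intro!: exI[of _ "1::'p"] exI[of _ "1::nat"])
  have "is_cone N"
    unfolding is_cone_def
  proof (intro conjI ballI impI)
    show "1 \<in> N" using MN one by auto
  next
    fix x y assume "x \<in> N" "y \<in> N"
    then obtain m k m' k' where "x = m * g ^ k" "y = m' * g ^ k'" "m \<in> M" "m' \<in> M"
      unfolding N_def by auto
    then have "x * y = (m * m') * g ^ (k + k')" "m * m' \<in> M"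
      by (auto simp: power_add mult_ac mult)
    then show "x * y \<in> N" unfolding N_def by blast
  next
    fix x assume "x \<in> N" "inverse x \<in> N"
    then obtain m k m' k' where x: "x = m * g ^ k" "inverse x = m' * g ^ k'" "m \<in> M" "m' \<in> M"
      unfolding N_def by auto
    have eq: "(m * m') * g ^ (k + k') = 1"
      using semifield_right_inverse[of x] x by (simp add: power_add mult_ac)
    then have "inverse g ^ (k + k') = m * m'"
      unfolding semifield_inverse_power[symmetric]
      by (intro semifield_inverse_unique) (simp add: mult.commute)
    then have "k + k' = 0" using neg mult[OF x(3,4)] by (metis gr_zeroI)
    then have "m * m' = 1" "x = m" using eq x by auto
    then have "inverse m = m'" by (intro semifield_inverse_unique)
    then show "x = 1" using inv[OF x(3)] x(4) \<open>x = m\<close> by simp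
  qed
  then have "N = M" using max MN by blast
  then show False using gN g by blast
qed

lemma ex_total_cone:
  "\<exists>M :: 'p::semifield set. is_cone M \<and> (\<forall>x. x \<in> M \<or> inverse x \<in> M)"
proof -
  have "\<exists>M\<in>Collect (is_cone :: 'p set \<Rightarrow> bool). \<forall>X\<in>Collect is_cone. M \<subseteq> X \<longrightarrow> X = M"
  proof (rule subset_Zorn_nonempty)
    have "is_cone {1 :: 'p}" by (auto simp: is_cone_def)
    then show "Collect (is_cone :: 'p set \<Rightarrow> bool) \<noteq> {}" by blast
  next
    fix C :: "'p set set"
    assume C: "C \<noteq> {}" "subset.chain (Collect is_cone) C"
    have cone: "\<And>X. X \<in> C \<Longrightarrow> is_cone X" and
      tot: "\<And>X Y. X \<in> C \<Longrightarrow> Y \<in> C \<Longrightarrow> X \<subseteq> Y \<or> Y \<subseteq> X"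
      using C(2) unfolding subset_chain_def by blast+
    have "is_cone (\<Union>C)"
      unfolding is_cone_def
    proof (intro conjI ballI impI)
      show "1 \<in> \<Union>C" using C(1) cone by (auto simp: is_cone_def)
    next
      fix x y assume "x \<in> \<Union>C" "y \<in> \<Union>C"
      then obtain X where "X \<in> C" "x \<in> X" "y \<in> X" using tot by blast
      then show "x * y \<in> \<Union>C" using cone by (auto simp: is_cone_def)
    next
      fix x assume "x \<in> \<Union>C" "inverse x \<in> \<Union>C"
      then obtain X where "X \<in> C" "x \<in> X" "inverse x \<in> X" using tot by blast
      then show "x = 1" using cone by (auto simp: is_cone_def)
    qed
    then show "\<Union>C \<in> Collect is_cone" by simp
  qed
  then obtain M :: "'p set" where M: "is_cone M" and max: "\<forall>X. is_cone X \<longrightarrow> M \<subseteq> X \<longrightarrow> X = M"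
    by blast
  have "x \<in> M \<or> inverse x \<in> M" for x
  proof (rule ccontr)
    assume *: "\<not> (x \<in> M \<or> inverse x \<in> M)"
    obtain k where k: "k > 0" "inverse x ^ k \<in> M"
      using cone_extend[OF M max] * by blast
    obtain j where j: "j > 0" "x ^ j \<in> M"
      using cone_extend[OF M max, of "inverse x"] * by (auto simp: semifield_inverse_inverse)
    have "x ^ (j * k) \<in> M"
      using cone_power[OF M j(2), of k] by (simp add: power_mult)
    moreover have "inverse x ^ (j * k) \<in> M"
      unfolding mult.commute[of j k] using cone_power[OF M k(2), of j] by (simp only: power_mult)
    ultimately
    have "x ^ (j * k) = 1"
      using M by (auto simp: is_cone_def semifield_inverse_power)
    then have "x = 1" by (rule semifield_torsion_free) (simp add: j(1) k(1))
    then show False using * M by (auto simp: is_cone_def)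
  qed
  then show ?thesis using M by blast
qed

definition total_cone :: "'p::semifield set" where
  "total_cone = (SOME M. is_cone M \<and> (\<forall>x. x \<in> M \<or> inverse x \<in> M))"

lemma total_cone:
  fixes x y :: "'p::semifield"
  shows "1 \<in> (total_cone :: 'p set)"
    and "x \<in> total_cone \<Longrightarrow> y \<in> total_cone \<Longrightarrow> x * y \<in> total_cone"
    and "x \<in> total_cone \<Longrightarrow> inverse x \<in> total_cone \<Longrightarrow> x = 1"
    and "x \<in> total_cone \<or> inverse x \<in> total_cone"
proof -
  have *: "is_cone (total_cone :: 'p set) \<and> (\<forall>x :: 'p. x \<in> total_cone \<or> inverse x \<in> total_cone)"
    unfolding total_cone_def by (rule someI_ex) (rule ex_total_cone)
  show "1 \<in> (total_cone :: 'p set)"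
    using * by (simp only: is_cone_def)
  show "x \<in> total_cone \<Longrightarrow> y \<in> total_cone \<Longrightarrow> x * y \<in> total_cone"
    using * unfolding is_cone_def by blast
  show "x \<in> total_cone \<Longrightarrow> inverse x \<in> total_cone \<Longrightarrow> x = 1"
    using * unfolding is_cone_def by blast
  show "x \<in> total_cone \<or> inverse x \<in> total_cone"
    using * by blast
qed

lemma semifield_inverse_quotient: "inverse (b / a) = (a / b :: 'p::semifield)"
  unfolding semifield_divide_inverse semifield_inverse_mult semifield_inverse_inverse
  by (rule mult.commute)

lemma semifield_quotient_mult: "(b / a) * (c / b) = (c / a :: 'p::semifield)"
proof -
  have "(b / a) * (c / b) = b * (inverse b * (c * inverse a))"
    unfolding semifield_divide_inverse by (simp only: ac_simps)
  then show ?thesis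
    by (simp only: semifield_mult_inverse_cancel semifield_divide_inverse)
qed

lemma semifield_quotient_cancel: "c * b / (c * a) = (b / a :: 'p::semifield)"
proof -
  have "c * b / (c * a) = c * (inverse c * (b * inverse a))"
    unfolding semifield_divide_inverse semifield_inverse_mult by (simp only: ac_simps)
  then show ?thesis
    by (simp only: semifield_mult_inverse_cancel semifield_divide_inverse)
qed

lemma semifield_quotient_eq_1:
  fixes a b :: "'p::semifield"
  assumes "b / a = 1"
  shows "a = b"
proof -
  have "b * inverse a = a * inverse a"
    using assms unfolding semifield_divide_inverse semifield_right_inverse .
  then show ?thesis by (rule semifield_cancel[symmetric])
qed


section \<open>Group ring, its fraction field and rational functions\<close>

text \<open>\<open>poly_mapping\<close> multiplies by adding exponents, so the group ring of the multiplicative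
  group of a semifield uses an additively written copy of that group as exponents.\<close>

typedef 'p additive = "UNIV :: 'p set"
  morphisms mult_of add_of ..

setup_lifting type_definition_additive

instantiation additive :: (semifield) linordered_ab_group_add
begin

lift_definition zero_additive :: "'a additive" is 1 .
lift_definition plus_additive :: "'a additive \<Rightarrow> 'a additive \<Rightarrow> 'a additive" is "(*)" .
lift_definition uminus_additive :: "'a additive \<Rightarrow> 'a additive" is inverse .
lift_definition minus_additive :: "'a additive \<Rightarrow> 'a additive \<Rightarrow> 'a additive" is "(/)" .
lift_definition less_eq_additive :: "'a additive \<Rightarrow> 'a additive \<Rightarrow> bool"
  is "\<lambda>a b. b / a \<in> total_cone" .
definition less_additive :: "'a additive \<Rightarrow> 'a additive \<Rightarrow> bool"
  where "less_additive a b \<longleftrightarrow> a \<le> b \<and> \<not> b \<le> a"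

instance
proof
  fix a b c :: "'a additive"
  show "a + b + c = a + (b + c)" by transfer (simp add: mult.assoc)
  show "a + b = b + a" by transfer (simp add: mult.commute)
  show "0 + a = a" by transfer simp
  show "- a + a = 0" by transfer (simp add: semifield_left_inverse)
  show "a - b = a + - b" by transfer (simp add: semifield_divide_inverse)
  show "a < b \<longleftrightarrow> a \<le> b \<and> \<not> b \<le> a" by (rule less_additive_def)
  show "a \<le> a"
    unfolding less_eq_additive.rep_eq semifield_divide_inverse semifield_right_inverse
    by (rule total_cone(1))
  show "a \<le> c" if "a \<le> b" "b \<le> c"
    using total_cone(2)[of "mult_of b / mult_of a" "mult_of c / mult_of b"] that
    unfolding less_eq_additive.rep_eq semifield_quotient_mult by blast
  show "a = b" if "a \<le> b" "b \<le> a"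
    using total_cone(3)[of "mult_of b / mult_of a"] that
    unfolding less_eq_additive.rep_eq semifield_inverse_quotient
    by (metis mult_of_inject semifield_quotient_eq_1)
  show "a \<le> b \<or> b \<le> a"
    using total_cone(4)[of "mult_of b / mult_of a"]
    unfolding less_eq_additive.rep_eq semifield_inverse_quotient .
  show "c + a \<le> c + b" if "a \<le> b"
    using that unfolding less_eq_additive.rep_eq plus_additive.rep_eq semifield_quotient_cancel .
qed

end

type_synonym 'p ZP = "'p additive \<Rightarrow>\<^sub>0 int"
type_synonym 'p QP = "'p ZP fract"

text \<open>Variables are indexed by pairs \<open>(i, l)\<close>; the type \<open>'p QPs\<close> is the field of rational
  functions over the fraction field of the group ring in all variables \<open>s\<^sub>i\<^sub>l\<close>,
  \<open>i\<close> and \<open>l\<close> natural numbers. Those with \<open>(i, l)\<close> in a prescribed finite set are selected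
  by the carrier sets below.\<close>

type_synonym 'p QPs = "((nat \<times> nat \<Rightarrow>\<^sub>0 nat) \<Rightarrow>\<^sub>0 'p QP) fract"

definition ZP_to_QPs :: "'p::semifield ZP \<Rightarrow> 'p QPs" where
  "ZP_to_QPs a = Fract (Poly_Mapping.single 0 (Fract a 1)) 1"

definition P_to_QPs :: "'p::semifield \<Rightarrow> 'p QPs" where
  "P_to_QPs p = ZP_to_QPs (Poly_Mapping.single (add_of p) 1)"

definition s_var :: "nat \<times> nat \<Rightarrow> 'p::semifield QPs" where
  "s_var d = Fract (Poly_Mapping.single (Poly_Mapping.single d 1) 1) 1"

definition NP :: "'p::semifield ZP set" where
  "NP = {a. \<forall>p. Poly_Mapping.lookup a p \<ge> 0}"

definition pi_P0 :: "'p::semifield ZP \<Rightarrow> 'p adjoin_zero" where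
  "pi_P0 a = (\<Sum>p\<in>Poly_Mapping.keys a. of_nat (nat (Poly_Mapping.lookup a p)) * Elt (mult_of p))"

text \<open>The polynomial expressions with coefficients in \<open>NP\<close> in the elements of \<open>X\<close>,
  as elements of the field of rational functions.\<close>

inductive_set NP_adjoin :: "'p::semifield QPs set \<Rightarrow> 'p QPs set" for X where
  const: "a \<in> NP \<Longrightarrow> ZP_to_QPs a \<in> NP_adjoin X"
| gen: "x \<in> X \<Longrightarrow> x \<in> NP_adjoin X"
| add: "f \<in> NP_adjoin X \<Longrightarrow> g \<in> NP_adjoin X \<Longrightarrow> f + g \<in> NP_adjoin X"
| mult: "f \<in> NP_adjoin X \<Longrightarrow> g \<in> NP_adjoin X \<Longrightarrow> f * g \<in> NP_adjoin X"


section \<open>Generalized and ordinary mutations\<close>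

text \<open>Tuples and matrices are extensional functions on their index sets; a matrix is a
  function of the index pair.\<close>

definition skew_symmetrizable :: "'i set \<Rightarrow> ('i \<times> 'i \<Rightarrow> int) \<Rightarrow> bool" where
  "skew_symmetrizable I B \<longleftrightarrow>
     (\<exists>d. (\<forall>i\<in>I. d i > (0::int)) \<and> (\<forall>i\<in>I. \<forall>j\<in>I. d i * B (i, j) = - (d j * B (j, i))))"

definition mutate_matrix ::
    "'i set \<Rightarrow> nat \<Rightarrow> 'i \<Rightarrow> ('i \<times> 'i \<Rightarrow> int) \<Rightarrow> 'i \<times> 'i \<Rightarrow> int" where
  "mutate_matrix I rk k B = (\<lambda>(i, j)\<in>I \<times> I.
     if i = k \<or> j = k then - B (i, j)
     else B (i, j) + int rk * (B (i, k) * max (B (k, j)) 0 + max (- B (i, k)) 0 * B (k, j)))"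

text \<open>The coefficient mutation; \<open>w\<close> is the value at \<open>y k\<close> of the exchange polynomial in
  direction \<open>k\<close>, and \<open>rk\<close> is the degree of that polynomial.\<close>

definition mutate_y ::
    "'i set \<Rightarrow> nat \<Rightarrow> 'a \<Rightarrow> 'i \<Rightarrow> ('i \<times> 'i \<Rightarrow> int) \<Rightarrow> ('i \<Rightarrow> 'a) \<Rightarrow> 'i \<Rightarrow> 'a::{comm_monoid_mult, inverse}"
  where
  "mutate_y I rk w k B y = (\<lambda>i\<in>I.
     if i = k then inverse (y k)
     else y i * (y k ^ nat (max (B (k, i)) 0)) ^ rk * w powi (- B (k, i)))"

record 'p gen_seed =
  gy :: "nat \<Rightarrow> 'p"
  gZ :: "nat \<Rightarrow> 'p ZP poly"
  gB :: "nat \<times> nat \<Rightarrow> int"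

definition is_gen_seed :: "nat \<Rightarrow> (nat \<Rightarrow> nat) \<Rightarrow> 'p::semifield gen_seed \<Rightarrow> bool" where
  "is_gen_seed n r \<Sigma> \<longleftrightarrow>
     gy \<Sigma> \<in> extensional {1..n} \<and>
     gZ \<Sigma> \<in> extensional {1..n} \<and>
     gB \<Sigma> \<in> extensional ({1..n} \<times> {1..n}) \<and>
     (\<forall>i\<in>{1..n}. degree (gZ \<Sigma> i) = r i \<and> (\<forall>l. coeff (gZ \<Sigma> i) l \<in> NP) \<and>
        coeff (gZ \<Sigma> i) 0 = 1 \<and> coeff (gZ \<Sigma> i) (r i) = 1) \<and>
     skew_symmetrizable {1..n} (gB \<Sigma>)"

text \<open>The value of an exchange polynomial in the semifield. It is formed in the semifield with
  zero adjoined and is nonzero because the constant coefficient is \<open>1\<close>.\<close>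

definition eval_P0 :: "'p::semifield ZP poly \<Rightarrow> 'p \<Rightarrow> 'p" where
  "eval_P0 Z y = unElt (\<Sum>l\<le>degree Z. pi_P0 (coeff Z l) * Elt y ^ l)"

definition mutate_gen ::
    "nat \<Rightarrow> (nat \<Rightarrow> nat) \<Rightarrow> nat \<Rightarrow> 'p::semifield gen_seed \<Rightarrow> 'p gen_seed" where
  "mutate_gen n r k \<Sigma> =
     \<lparr>gy = mutate_y {1..n} (r k) (eval_P0 (gZ \<Sigma> k) (gy \<Sigma> k)) k (gB \<Sigma>) (gy \<Sigma>),
      gZ = (\<lambda>i\<in>{1..n}. if i = k then (\<Sum>l\<le>r k. monom (coeff (gZ \<Sigma> k) (r k - l)) l) else gZ \<Sigma> i),
      gB = mutate_matrix {1..n} (r k) k (gB \<Sigma>)\<rparr>"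

record ('i, 'a) Y_seed =
  oy :: "'i \<Rightarrow> 'a"
  oB :: "'i \<times> 'i \<Rightarrow> int"

text \<open>Ordinary mutation: all degrees are \<open>1\<close> and all exchange polynomials are \<open>1 + u\<close>.
  The coefficients lie in a semifield contained in a field, with the operations of the field.\<close>

definition mutate_ord :: "'i set \<Rightarrow> 'i \<Rightarrow> ('i, 'a::field) Y_seed \<Rightarrow> ('i, 'a) Y_seed" where
  "mutate_ord I k \<Sigma> =
     \<lparr>oy = mutate_y I 1 (1 + oy \<Sigma> k) k (oB \<Sigma>) (oy \<Sigma>),
      oB = mutate_matrix I 1 k (oB \<Sigma>)\<rparr>"


section \<open>Patterns on the labeled regular tree\<close>

text \<open>\<open>adj k v w\<close> says that \<open>v\<close> and \<open>w\<close> are joined by an edge labeled \<open>k\<close>. A tree is a graph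
  in which any two vertices are joined by exactly one simple path.\<close>

definition labeled_regular_tree :: "nat \<Rightarrow> 'v set \<Rightarrow> (nat \<Rightarrow> 'v \<Rightarrow> 'v \<Rightarrow> bool) \<Rightarrow> bool" where
  "labeled_regular_tree n V adj \<longleftrightarrow>
     (\<forall>k v w. adj k v w \<longrightarrow> k \<in> {1..n} \<and> v \<in> V \<and> w \<in> V \<and> v \<noteq> w \<and> adj k w v) \<and>
     (\<forall>k m v w. adj k v w \<and> adj m v w \<longrightarrow> k = m) \<and>
     (\<forall>v\<in>V. \<forall>k\<in>{1..n}. \<exists>!w. adj k v w) \<and>
     (\<forall>v\<in>V. \<forall>w\<in>V. \<exists>!xs. xs \<noteq> [] \<and> hd xs = v \<and> last xs = w \<and> distinct xs \<and>
        successively (\<lambda>a b. \<exists>k. adj k a b) xs)"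

definition gen_Y_pattern ::
    "nat \<Rightarrow> (nat \<Rightarrow> nat) \<Rightarrow> 'v set \<Rightarrow> (nat \<Rightarrow> 'v \<Rightarrow> 'v \<Rightarrow> bool) \<Rightarrow> ('v \<Rightarrow> 'p::semifield gen_seed) \<Rightarrow> bool"
  where
  "gen_Y_pattern n r V adj G \<longleftrightarrow>
     (\<forall>t\<in>V. is_gen_seed n r (G t)) \<and>
     (\<forall>k t t'. adj k t t' \<longrightarrow> G t' = mutate_gen n r k (G t))"

definition idx :: "nat \<Rightarrow> (nat \<Rightarrow> nat) \<Rightarrow> (nat \<times> nat) set" where
  "idx n r = {(i, l). 1 \<le> i \<and> i \<le> n \<and> 1 \<le> l \<and> l \<le> r i}"

definition mutate_comp ::
    "nat \<Rightarrow> (nat \<Rightarrow> nat) \<Rightarrow> nat \<Rightarrow> (nat \<times> nat, 'a::field) Y_seed \<Rightarrow> (nat \<times> nat, 'a) Y_seed" where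
  "mutate_comp n r k = fold (\<lambda>l. mutate_ord (idx n r) (k, l)) [1..<Suc (r k)]"

definition initial_comp_seed ::
    "nat \<Rightarrow> (nat \<Rightarrow> nat) \<Rightarrow> 'p::semifield gen_seed \<Rightarrow> (nat \<times> nat, 'p QPs) Y_seed" where
  "initial_comp_seed n r \<Sigma> =
     \<lparr>oy = (\<lambda>(i, l)\<in>idx n r. s_var (i, l) * P_to_QPs (gy \<Sigma> i)),
      oB = (\<lambda>((i, l), (j, m))\<in>idx n r \<times> idx n r. gB \<Sigma> (i, j))\<rparr>"

definition comp_Y_pattern ::
    "nat \<Rightarrow> (nat \<Rightarrow> nat) \<Rightarrow> (nat \<Rightarrow> 'v \<Rightarrow> 'v \<Rightarrow> bool) \<Rightarrow> 'v \<Rightarrow> 'p::semifield gen_seed \<Rightarrow>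
     ('v \<Rightarrow> (nat \<times> nat, 'p QPs) Y_seed) \<Rightarrow> bool"
  where
  "comp_Y_pattern n r adj t0 \<Sigma> C \<longleftrightarrow>
     C t0 = initial_comp_seed n r \<Sigma> \<and>
     (\<forall>k t t'. adj k t t' \<longrightarrow> C t' = mutate_comp n r k (C t))"


section \<open>The extended semifield and its quotient\<close>

definition P_bar :: "nat \<Rightarrow> (nat \<Rightarrow> nat) \<Rightarrow> 'p::semifield QPs set" where
  "P_bar n r = {f / g | f g. f \<in> NP_adjoin (s_var ` idx n r) - {0} \<and>
                            g \<in> NP_adjoin (s_var ` idx n r) - {0}}"

definition elem_sym :: "(nat \<Rightarrow> nat) \<Rightarrow> nat \<times> nat \<Rightarrow> 'p::semifield QPs" where
  "elem_sym r = (\<lambda>(i, l). \<Sum>A | A \<subseteq> {1..r i} \<and> card A = l. \<Prod>m\<in>A. s_var (i, m))"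

definition NP_e :: "nat \<Rightarrow> (nat \<Rightarrow> nat) \<Rightarrow> 'p::semifield QPs set" where
  "NP_e n r = NP_adjoin (elem_sym r ` idx n r)"

definition init_z :: "'p::semifield gen_seed \<Rightarrow> nat \<times> nat \<Rightarrow> 'p adjoin_zero" where
  "init_z \<Sigma> = (\<lambda>(i, l). pi_P0 (coeff (gZ \<Sigma> i) l))"

text \<open>\<open>psi\<close> exists because the elementary symmetric polynomials are algebraically independent;
  it is unique because they generate \<open>NP_e n r\<close> over \<open>NP\<close>.\<close>

definition psi ::
    "nat \<Rightarrow> (nat \<Rightarrow> nat) \<Rightarrow> (nat \<times> nat \<Rightarrow> 'p adjoin_zero) \<Rightarrow> 'p::semifield QPs \<Rightarrow> 'p adjoin_zero" where
  "psi n r z = (THE h. h \<in> extensional (NP_e n r) \<and>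
     (\<forall>f\<in>NP_e n r. \<forall>g\<in>NP_e n r. h (f + g) = h f + h g \<and> h (f * g) = h f * h g) \<and>
     (\<forall>a\<in>NP. h (ZP_to_QPs a) = pi_P0 a) \<and>
     (\<forall>d\<in>idx n r. h (elem_sym r d) = z d))"

definition S_semi ::
    "nat \<Rightarrow> (nat \<Rightarrow> nat) \<Rightarrow> (nat \<times> nat \<Rightarrow> 'p adjoin_zero) \<Rightarrow> 'p::semifield QPs set" where
  "S_semi n r z = {f / g | f g. f / g \<in> P_bar n r \<and> f \<in> NP_e n r \<and> g \<in> NP_e n r \<and>
                                psi n r z f \<noteq> 0 \<and> psi n r z g \<noteq> 0}"

text \<open>The extension of \<open>psi\<close> to fractions: \<open>psi (f / g) = psi f / psi g\<close>.\<close>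

definition psi_S ::
    "nat \<Rightarrow> (nat \<Rightarrow> nat) \<Rightarrow> (nat \<times> nat \<Rightarrow> 'p adjoin_zero) \<Rightarrow> 'p::semifield QPs \<Rightarrow> 'p" where
  "psi_S n r z x = (THE p. \<exists>f\<in>NP_e n r. \<exists>g\<in>NP_e n r. \<exists>a b.
     x = f / g \<and> psi n r z f = Elt a \<and> psi n r z g = Elt b \<and> p = a / b)"

definition S_sim ::
    "nat \<Rightarrow> (nat \<Rightarrow> nat) \<Rightarrow> (nat \<times> nat \<Rightarrow> 'p adjoin_zero) \<Rightarrow> ('p::semifield QPs \<times> 'p QPs) set" where
  "S_sim n r z = {(f, g). f \<in> S_semi n r z \<and> g \<in> S_semi n r z \<and> psi_S n r z f = psi_S n r z g}"

definition S_class ::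
    "nat \<Rightarrow> (nat \<Rightarrow> nat) \<Rightarrow> (nat \<times> nat \<Rightarrow> 'p adjoin_zero) \<Rightarrow> 'p::semifield QPs \<Rightarrow> 'p QPs set" where
  "S_class n r z f = S_sim n r z `` {f}"

text \<open>The quotient with the multiplication of classes; roots involve no addition.\<close>

definition S_quot ::
    "nat \<Rightarrow> (nat \<Rightarrow> nat) \<Rightarrow> (nat \<times> nat \<Rightarrow> 'p adjoin_zero) \<Rightarrow> 'p::semifield QPs set monoid" where
  "S_quot n r z =
     \<lparr>carrier = S_semi n r z // S_sim n r z,
      monoid.mult = (\<lambda>X Y. \<Union>f\<in>X. \<Union>g\<in>Y. S_class n r z (f * g)),
      one = S_class n r z 1\<rparr>"

definition is_nth_root :: "('a, 'b) monoid_scheme \<Rightarrow> nat \<Rightarrow> 'a \<Rightarrow> 'a \<Rightarrow> bool" where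
  "is_nth_root M m a x \<longleftrightarrow> x \<in> carrier M \<and> x [^]\<^bsub>M\<^esub> m = a"

definition nth_root_in :: "('a, 'b) monoid_scheme \<Rightarrow> nat \<Rightarrow> 'a \<Rightarrow> 'a" where
  "nth_root_in M m a = (THE x. is_nth_root M m a x)"

end

theory Submission
  imports Defs
    "HOL-Library.Product_Plus"
    "HOL-Computational_Algebra.Polynomial_Factorial"
begin

text \<open>
  Mutating all \<open>(k, 1), \<dots>, (k, r\<^sub>k)\<close> multiplies the coefficients \<open>y\<^sub>i\<^sub>1, \<dots>, y\<^sub>i\<^sub>r\<close> with \<open>i \<noteq> k\<close> by one
  common factor and inverts the \<open>y\<^sub>k\<^sub>l\<close>. Hence at every vertex \<open>y\<^sub>i\<^sub>l = s\<^sub>i\<^sub>l Q\<^sub>i\<close> for all \<open>l\<close>, or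
  \<open>y\<^sub>i\<^sub>l = s\<^sub>i\<^sub>l\<^sup>-\<^sup>1 Q\<^sub>i\<close> for all \<open>l\<close>, the two cases according to whether the exchange polynomial
  at \<open>i\<close> is the initial one or its reverse. The product of the \<open>1 + y\<^sub>k\<^sub>l\<close> over \<open>l\<close> expands into
  the elementary symmetric polynomials, so \<open>\<psi>\<close> maps it to the value of the exchange polynomial at
  \<open>\<psi>(Q\<^sub>k)\<close>, and by induction along the tree \<open>\<psi>(Q\<^sub>i)\<close> is the generalized coefficient. The product
  of the \<open>y\<^sub>i\<^sub>l\<close> over \<open>l\<close> is \<open>Q\<^sub>i\<close> to the power \<open>r\<^sub>i\<close> times the top elementary symmetric polynomial or
  its inverse, which \<open>\<psi>\<close> maps to \<open>1\<close>. Roots are unique because a semifield is torsion-free.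
  That \<open>\<psi>\<close> exists is the algebraic independence of the elementary symmetric polynomials, which
  follows from the injectivity of the lexicographically leading exponent on their monomials.
\<close>


section \<open>Leading exponents\<close>

text \<open>Fixing the leading coefficient to be 1 makes the notion stable under products over any
  commutative ring.\<close>

definition monic_lead ::
    "('m::{linorder, zero} \<Rightarrow>\<^sub>0 'a::{zero, one}) \<Rightarrow> 'm \<Rightarrow> bool" where
  "monic_lead f \<mu> \<longleftrightarrow> Poly_Mapping.lookup f \<mu> = 1 \<and> (\<forall>\<nu>\<in>Poly_Mapping.keys f. \<nu> \<le> \<mu>)"

lemma monic_lead_lookup_eq_0: "monic_lead f \<mu> \<Longrightarrow> \<mu> < \<nu> \<Longrightarrow> Poly_Mapping.lookup f \<nu> = 0"
  by (meson in_keys_iff linorder_not_less monic_lead_def)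

lemma monic_lead_1:
  "monic_lead (1 :: 'm::{linorder, comm_monoid_add} \<Rightarrow>\<^sub>0 'a::comm_ring_1) 0"
  by (simp add: monic_lead_def)

text \<open>Splitting off the leading terms leaves \<open>f'\<close> and \<open>g'\<close>, whose
  exponents lie strictly below \<mu> and \<nu>. Addition is strictly monotone, so the exponent \<mu>
  + \<nu> arises only from the product of the two leading terms.\<close>

lemma monic_lead_mult:
  fixes f g :: "'m::{linorder, ordered_cancel_comm_monoid_add} \<Rightarrow>\<^sub>0 'a::comm_ring_1"
  assumes f: "monic_lead f \<mu>" and g: "monic_lead g \<nu>"
  shows "monic_lead (f * g) (\<mu> + \<nu>)"
proof -
  have le: "\<kappa> \<le> \<mu> + \<nu>" if \<kappa>: "\<kappa> \<in> Poly_Mapping.keys (f * g)" for \<kappa>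
  proof -
    obtain a b where "\<kappa> = a + b" "a \<in> Poly_Mapping.keys f" "b \<in> Poly_Mapping.keys g"
      using \<kappa> keys_mult[of f g] by blast
    then show ?thesis using f g by (auto simp: monic_lead_def intro: add_mono)
  qed
  define f' where "f' = f - Poly_Mapping.single \<mu> 1"
  define g' where "g' = g - Poly_Mapping.single \<nu> 1"
  have f'_lt: "\<kappa> < \<mu>" if "\<kappa> \<in> Poly_Mapping.keys f'" for \<kappa>
    using that f unfolding f'_def monic_lead_def
    by (cases "\<kappa> = \<mu>") (auto simp: in_keys_iff lookup_minus lookup_single when_def
        order_less_le split: if_splits)
  have g'_lt: "\<kappa> < \<nu>" if "\<kappa> \<in> Poly_Mapping.keys g'" for \<kappa>
    using that g unfolding g'_def monic_lead_def
    by (cases "\<kappa> = \<nu>") (auto simp: in_keys_iff lookup_minus lookup_single when_def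
        order_less_le split: if_splits)
  have "\<mu> + \<nu> \<notin> Poly_Mapping.keys (f' * g)"
  proof
    assume "\<mu> + \<nu> \<in> Poly_Mapping.keys (f' * g)"
    then obtain a b where "\<mu> + \<nu> = a + b" "a \<in> Poly_Mapping.keys f'" "b \<in> Poly_Mapping.keys g"
      using keys_mult[of f' g] by blast
    moreover from this(2,3) have "a + b < \<mu> + \<nu>"
      using f'_lt g unfolding monic_lead_def by (intro add_less_le_mono) auto
    ultimately show False by simp
  qed
  moreover have "\<mu> + \<nu> \<notin> Poly_Mapping.keys (Poly_Mapping.single \<mu> 1 * g')"
  proof
    assume "\<mu> + \<nu> \<in> Poly_Mapping.keys (Poly_Mapping.single \<mu> 1 * g')"
    then obtain a b where "\<mu> + \<nu> = a + b"
        "a \<in> Poly_Mapping.keys (Poly_Mapping.single \<mu> (1::'a))" "b \<in> Poly_Mapping.keys g'"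
      using keys_mult[of "Poly_Mapping.single \<mu> 1" g'] by blast
    moreover from this(2,3) have "a + b < \<mu> + \<nu>"
      using g'_lt by (intro add_le_less_mono) (auto split: if_splits)
    ultimately show False by simp
  qed
  moreover have "f * g = f' * g + Poly_Mapping.single \<mu> 1 * g'
      + Poly_Mapping.single \<mu> 1 * Poly_Mapping.single \<nu> 1"
    by (simp add: f'_def g'_def algebra_simps)
  ultimately have "Poly_Mapping.lookup (f * g) (\<mu> + \<nu>) = 1"
    by (simp add: lookup_add in_keys_iff mult_single)
  then show ?thesis using le by (simp add: monic_lead_def)
qed

lemma monic_lead_prod:
  fixes f :: "'i \<Rightarrow> 'm::{linorder, ordered_cancel_comm_monoid_add} \<Rightarrow>\<^sub>0 'a::comm_ring_1"
  assumes "\<And>i. i \<in> A \<Longrightarrow> monic_lead (f i) (\<mu> i)"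
  shows "monic_lead (\<Prod>i\<in>A. f i) (\<Sum>i\<in>A. \<mu> i)"
  using assms by (induction A rule: infinite_finite_induct) (auto intro: monic_lead_1 monic_lead_mult)

text \<open>The exponent is \<open>k\<close> times \<mu>, written as a sum because the exponents
  form an arbitrary ordered monoid.\<close>

lemma monic_lead_power:
  fixes f :: "'m::{linorder, ordered_cancel_comm_monoid_add} \<Rightarrow>\<^sub>0 'a::comm_ring_1"
  assumes "monic_lead f \<mu>"
  shows "monic_lead (f ^ k) (\<Sum>j<k. \<mu>)"
  using monic_lead_prod[of "{..<k}" "\<lambda>_. f" "\<lambda>_. \<mu>"] assms by simp


section \<open>Algebraic independence of the elementary symmetric polynomials\<close>

text \<open>Exponent of the squarefree monomial formed by the variables \<open>(i, m)\<close> with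
  \<open>m\<close> in \<open>A\<close>.\<close>

definition set_expo :: "nat \<Rightarrow> nat set \<Rightarrow> nat \<times> nat \<Rightarrow>\<^sub>0 nat" where
  "set_expo i A = (\<Sum>m\<in>A. Poly_Mapping.single (i, m) 1)"

definition elem_sym_poly ::
    "(nat \<Rightarrow> nat) \<Rightarrow> nat \<times> nat \<Rightarrow> (nat \<times> nat \<Rightarrow>\<^sub>0 nat) \<Rightarrow>\<^sub>0 'a::idom" where
  "elem_sym_poly r = (\<lambda>(i, l). \<Sum>A | A \<subseteq> {1..r i} \<and> card A = l. Poly_Mapping.single (set_expo i A) 1)"

lemma lookup_set_expo:
  "finite A \<Longrightarrow> Poly_Mapping.lookup (set_expo i A) d = (if fst d = i \<and> snd d \<in> A then 1 else 0)"
  by (cases d) (auto simp: set_expo_def lookup_sum lookup_single when_def)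

lemma prod_single_set_expo:
  "finite A \<Longrightarrow> (\<Prod>m\<in>A. Poly_Mapping.single (Poly_Mapping.single (i, m) 1) 1)
    = (Poly_Mapping.single (set_expo i A) 1 :: _ \<Rightarrow>\<^sub>0 'a::idom)"
  by (induction A rule: finite_induct) (auto simp: set_expo_def mult_single)

lemma to_fract_sum: "to_fract (\<Sum>x\<in>X. f x) = (\<Sum>x\<in>X. to_fract (f x))"
  by (induction X rule: infinite_finite_induct) auto

lemma to_fract_prod: "to_fract (\<Prod>x\<in>X. f x) = (\<Prod>x\<in>X. to_fract (f x))"
  by (induction X rule: infinite_finite_induct) auto

lemma to_fract_power: "to_fract (x ^ k) = to_fract x ^ k"
  by (induction k) auto

text \<open>Moves the elementary symmetric polynomials from the fraction field to the polynomial
  ring, where exponents and coefficients can be read off.\<close>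

lemma elem_sym_eq_to_fract: "elem_sym r d = to_fract (elem_sym_poly r d)"
proof (cases d)
  case (Pair i l)
  have "(\<Prod>m\<in>A. s_var (i, m)) = to_fract (Poly_Mapping.single (set_expo i A) (1 :: 'a QP))"
    if "A \<subseteq> {1..r i}" for A
    using prod_single_set_expo[of A i, where 'a = "'a QP"] finite_subset[OF that]
    by (simp add: s_var_def flip: to_fract_def to_fract_prod)
  then show ?thesis
    by (simp add: Pair elem_sym_def elem_sym_poly_def to_fract_sum)
qed

text \<open>In the order on exponents the smaller variable is the more significant one. The first
  difference occurs at the least \<open>m\<close> in \<open>{1..l}\<close> missing from
  \<open>A\<close>, where \<open>A\<close> has exponent 0 and \<open>{1..l}\<close> has exponent
  1.\<close>

lemma set_expo_le:
  assumes A: "A \<subseteq> {1..R}" and "card A = l"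
  shows "set_expo i A \<le> set_expo i {1..l}"
proof (cases "A = {1..l}")
  case False
  have fin: "finite A" using A finite_subset by auto
  define D where "D = {1..l} - A"
  have "D \<noteq> {}"
  proof
    assume "D = {}"
    then have "{1..l} \<subseteq> A" by (auto simp: D_def)
    then show False using False card_subset_eq[OF fin, of "{1..l}"] assms by auto
  qed
  define m where "m = Min D"
  have "finite D" by (simp add: D_def)
  then have m: "m \<in> D" "\<And>j. j \<in> D \<Longrightarrow> m \<le> j"
    using \<open>D \<noteq> {}\<close> by (auto simp: m_def)
  have "set_expo i A < set_expo i {1..l}"
    unfolding less_poly_mapping.rep_eq less_fun_def
  proof (intro exI conjI allI impI)
    show "Poly_Mapping.lookup (set_expo i A) (i, m) < Poly_Mapping.lookup (set_expo i {1..l}) (i, m)"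
      using m(1) by (simp add: lookup_set_expo fin D_def)
  next
    fix d assume d: "d < (i, m)"
    show "Poly_Mapping.lookup (set_expo i A) d = Poly_Mapping.lookup (set_expo i {1..l}) d"
    proof (cases "fst d = i")
      case True
      then have "snd d < m" using d by (cases d) (auto simp: less_prod_def)
      moreover have "m \<le> l" using m(1) by (auto simp: D_def)
      \<comment> \<open>Index 0 lies in neither set. A positive index below \<open>m\<close> lies in
        \<open>{1..l}\<close>, hence in \<open>A\<close> by minimality of \<open>m\<close>.\<close>
      ultimately have "snd d \<in> A \<longleftrightarrow> snd d \<in> {1..l}"
        using m(2)[of "snd d"] A by (auto simp: D_def)
      then show ?thesis by (simp add: lookup_set_expo fin)
    qed (simp add: lookup_set_expo fin)
  qed
  then show ?thesis by simp
qed simp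

lemma inj_on_set_expo: "inj_on (set_expo i) (Collect finite)"
proof (rule inj_onI)
  fix A B :: "nat set"
  assume *: "A \<in> Collect finite" "B \<in> Collect finite" "set_expo i A = set_expo i B"
  have "m \<in> A \<longleftrightarrow> m \<in> B" for m
    using arg_cong[OF *(3), of "\<lambda>f. Poly_Mapping.lookup f (i, m)"] *(1,2)
    by (simp add: lookup_set_expo split: if_splits)
  then show "A = B" by blast
qed

text \<open>The subset \<open>{1..l}\<close> gives the largest exponent, and as
  \<open>set_expo\<close> is injective on finite sets no other subset contributes to that
  coefficient. Membership in \<open>idx n r\<close> gives \<open>l \<le> r i\<close>, so
  \<open>{1..l}\<close> is among the subsets.\<close>

lemma monic_lead_elem_sym_poly:
  assumes "(i, l) \<in> idx n r"
  shows "monic_lead (elem_sym_poly r (i, l) :: _ \<Rightarrow>\<^sub>0 'a::idom) (set_expo i {1..l})"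
  unfolding monic_lead_def
proof
  let ?X = "{A. A \<subseteq> {1..r i} \<and> card A = l}"
  have fin: "finite ?X" by (rule finite_subset[of _ "Pow {1..r i}"]) auto
  have "Poly_Mapping.lookup (elem_sym_poly r (i, l) :: _ \<Rightarrow>\<^sub>0 'a) (set_expo i {1..l})
      = (\<Sum>A\<in>?X. if A = {1..l} then 1 else 0)"
    unfolding elem_sym_poly_def prod.case lookup_sum lookup_single when_def
  proof (rule sum.cong[OF refl])
    fix A assume "A \<in> ?X"
    then have "finite A" using finite_subset by auto
    then have "set_expo i A = set_expo i {1..l} \<longleftrightarrow> A = {1..l}"
      using inj_on_set_expo[of i] by (auto dest: inj_onD)
    then show "(if set_expo i A = set_expo i {1..l} then (1::'a) else 0) = (if A = {1..l} then 1 else 0)"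
      by simp
  qed
  also have "\<dots> = 1"
    using assms fin by (subst sum.delta) (auto simp: idx_def)
  finally show "Poly_Mapping.lookup (elem_sym_poly r (i, l) :: _ \<Rightarrow>\<^sub>0 'a) (set_expo i {1..l}) = 1" .
  show "\<forall>\<nu>\<in>Poly_Mapping.keys (elem_sym_poly r (i, l) :: _ \<Rightarrow>\<^sub>0 'a). \<nu> \<le> set_expo i {1..l}"
  proof
    fix \<nu> assume "\<nu> \<in> Poly_Mapping.keys (elem_sym_poly r (i, l) :: _ \<Rightarrow>\<^sub>0 'a)"
    then obtain A where "A \<in> ?X" "\<nu> \<in> Poly_Mapping.keys (Poly_Mapping.single (set_expo i A) (1::'a))"
      unfolding elem_sym_poly_def prod.case in_keys_iff lookup_sum
      by (metis (no_types, lifting) sum.not_neutral_contains_not_neutral)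
    then show "\<nu> \<le> set_expo i {1..l}" using set_expo_le[of A "r i" l i] by auto
  qed
qed

section \<open>Monomials in the elementary symmetric polynomials and their leading exponents\<close>

definition mon_val :: "('d \<Rightarrow> 'a::comm_monoid_mult) \<Rightarrow> ('d \<Rightarrow>\<^sub>0 nat) \<Rightarrow> 'a" where
  "mon_val x \<alpha> = (\<Prod>d\<in>Poly_Mapping.keys \<alpha>. x d ^ Poly_Mapping.lookup \<alpha> d)"

lemma mon_val_superset:
  assumes "finite D" "Poly_Mapping.keys \<alpha> \<subseteq> D"
  shows "mon_val x \<alpha> = (\<Prod>d\<in>D. x d ^ Poly_Mapping.lookup \<alpha> d)"
  unfolding mon_val_def
  by (rule prod.mono_neutral_left) (use assms in \<open>auto simp: in_keys_iff\<close>)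

lemma mon_val_add: "mon_val x (\<alpha> + \<beta>) = mon_val x \<alpha> * mon_val x \<beta>"
proof -
  let ?D = "Poly_Mapping.keys \<alpha> \<union> Poly_Mapping.keys \<beta>"
  have "mon_val x (\<alpha> + \<beta>) = (\<Prod>d\<in>?D. x d ^ Poly_Mapping.lookup (\<alpha> + \<beta>) d)"
    by (rule mon_val_superset) (use keys_add[of \<alpha> \<beta>] in auto)
  also have "\<dots> = (\<Prod>d\<in>?D. x d ^ Poly_Mapping.lookup \<alpha> d) * (\<Prod>d\<in>?D. x d ^ Poly_Mapping.lookup \<beta> d)"
    by (simp add: lookup_add power_add prod.distrib)
  also have "\<dots> = mon_val x \<alpha> * mon_val x \<beta>"
    by (subst (1 2) mon_val_superset[of ?D]) auto
  finally show ?thesis .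
qed

lemma mon_val_0 [simp]: "mon_val x 0 = 1"
  by (simp add: mon_val_def)

lemma mon_val_single [simp]: "mon_val x (Poly_Mapping.single d 1) = x d"
  by (simp add: mon_val_def)

text \<open>The leading exponents of the factors \<open>elem_sym_poly r d\<close>, each repeated as
  often as \<alpha> prescribes.\<close>

definition lead_expo :: "(nat \<times> nat \<Rightarrow>\<^sub>0 nat) \<Rightarrow> nat \<times> nat \<Rightarrow>\<^sub>0 nat" where
  "lead_expo \<alpha> = (\<Sum>d\<in>Poly_Mapping.keys \<alpha>. \<Sum>j<Poly_Mapping.lookup \<alpha> d. set_expo (fst d) {1..snd d})"

lemma monic_lead_mon_val_elem_sym_poly:
  assumes "Poly_Mapping.keys \<alpha> \<subseteq> idx n r"
  shows "monic_lead (mon_val (elem_sym_poly r) \<alpha> :: _ \<Rightarrow>\<^sub>0 'a::idom) (lead_expo \<alpha>)"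
  unfolding mon_val_def lead_expo_def
proof (intro monic_lead_prod monic_lead_power)
  fix d assume "d \<in> Poly_Mapping.keys \<alpha>"
  then show "monic_lead (elem_sym_poly r d :: _ \<Rightarrow>\<^sub>0 'a) (set_expo (fst d) {1..snd d})"
    using assms monic_lead_elem_sym_poly[of "fst d" "snd d" n r] by auto
qed

lemma finite_idx [simp]: "finite (idx n r)"
proof (rule finite_subset)
  show "idx n r \<subseteq> (SIGMA i:{1..n}. {1..r i})" by (auto simp: idx_def)
qed auto

text \<open>The leading monomial of the elementary symmetric polynomial \<open>(i, l)\<close>
  contains the variable \<open>(i, m)\<close> once if \<open>m \<le> l\<close> and not at all
  otherwise, which leaves a tail sum of \<alpha>.\<close>

lemma lookup_lead_expo:
  assumes \<alpha>: "Poly_Mapping.keys \<alpha> \<subseteq> idx n r" and "1 \<le> i" "i \<le> n" "1 \<le> m"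
  shows "Poly_Mapping.lookup (lead_expo \<alpha>) (i, m) = (\<Sum>l\<in>{m..r i}. Poly_Mapping.lookup \<alpha> (i, l))"
proof -
  have sum_Suc_0: "(\<Sum>j<k. Suc 0) = k" for k
    by simp
  have "Poly_Mapping.lookup (lead_expo \<alpha>) (i, m)
      = (\<Sum>d\<in>Poly_Mapping.keys \<alpha>. if fst d = i \<and> m \<le> snd d then Poly_Mapping.lookup \<alpha> d else 0)"
    using assms(4)
    by (auto simp: lead_expo_def lookup_sum lookup_set_expo sum_Suc_0 simp del: sum_constant intro!: sum.cong)
  also have "\<dots> = (\<Sum>d\<in>idx n r. if fst d = i \<and> m \<le> snd d then Poly_Mapping.lookup \<alpha> d else 0)"
    using \<alpha> by (intro sum.mono_neutral_left) (auto simp: in_keys_iff)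
  also have "\<dots> = (\<Sum>d\<in>{d\<in>idx n r. fst d = i \<and> m \<le> snd d}. Poly_Mapping.lookup \<alpha> d)"
    by (rule sum.inter_filter[symmetric]) simp
  also have "{d\<in>idx n r. fst d = i \<and> m \<le> snd d} = Pair i ` {m..r i}"
    using assms by (auto simp: idx_def)
  also have "(\<Sum>d\<in>\<dots>. Poly_Mapping.lookup \<alpha> d) = (\<Sum>l\<in>{m..r i}. Poly_Mapping.lookup \<alpha> (i, l))"
    by (subst sum.reindex) (auto simp: inj_on_def)
  finally show ?thesis .
qed

lemma inj_on_lead_expo: "inj_on lead_expo {\<alpha>. Poly_Mapping.keys \<alpha> \<subseteq> idx n r}"
proof (rule inj_onI)
  fix \<alpha> \<beta> :: "nat \<times> nat \<Rightarrow>\<^sub>0 nat"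
  assume *: "\<alpha> \<in> {\<alpha>. Poly_Mapping.keys \<alpha> \<subseteq> idx n r}" "\<beta> \<in> {\<alpha>. Poly_Mapping.keys \<alpha> \<subseteq> idx n r}"
    "lead_expo \<alpha> = lead_expo \<beta>"
  \<comment> \<open>An entry of the exponent is the difference of two consecutive tail sums. For
    \<open>l = r i\<close> the second one is empty.\<close>
  have last: "Poly_Mapping.lookup \<gamma> (i, l) = Poly_Mapping.lookup (lead_expo \<gamma>) (i, l)
      - Poly_Mapping.lookup (lead_expo \<gamma>) (i, Suc l)"
    if "(i, l) \<in> idx n r" "Poly_Mapping.keys \<gamma> \<subseteq> idx n r" for \<gamma> i l
  proof -
    have "{l..r i} = insert l {Suc l..r i}" using that(1) by (auto simp: idx_def)
    then show ?thesis
      using that by (subst (1 2) lookup_lead_expo[OF that(2)]) (auto simp: idx_def)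
  qed
  show "\<alpha> = \<beta>"
  proof (rule poly_mapping_eqI)
    fix d :: "nat \<times> nat"
    show "Poly_Mapping.lookup \<alpha> d = Poly_Mapping.lookup \<beta> d"
    proof (cases "d \<in> idx n r")
      case True
      then show ?thesis using last[of "fst d" "snd d"] * by simp
    next
      case False
      then show ?thesis using * by (metis in_keys_iff mem_Collect_eq subsetD)
    qed
  qed
qed


section \<open>Positive expressions in the elementary symmetric polynomials\<close>

text \<open>\<open>NP[e]\<close> is the image of the monoid semiring of \<open>\<nat>\<close>, on which a homomorphism can be
  prescribed freely: an exponent \<open>(p, \<alpha>)\<close> stands for the monomial \<open>p e\<^sup>\<alpha>\<close>.\<close>

type_synonym 'p NP_poly = "('p additive \<times> (nat \<times> nat \<Rightarrow>\<^sub>0 nat)) \<Rightarrow>\<^sub>0 nat"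

section \<open>Evaluation of formal positive polynomials\<close>

definition term_val ::
    "('p::semifield \<Rightarrow> 'a::comm_semiring_1) \<Rightarrow> (nat \<times> nat \<Rightarrow> 'a) \<Rightarrow>
     'p additive \<times> (nat \<times> nat \<Rightarrow>\<^sub>0 nat) \<Rightarrow> 'a" where
  "term_val c x = (\<lambda>(p, \<alpha>). c (mult_of p) * mon_val x \<alpha>)"

text \<open>Two instances matter: \<open>P_to_QPs\<close> with \<open>elem_sym r\<close>
  parametrizes \<open>NP_e n r\<close>, and \<open>Elt\<close> with \<open>z\<close> computes the
  values of \<psi>.\<close>

definition poly_val ::
    "('p::semifield \<Rightarrow> 'a::comm_semiring_1) \<Rightarrow> (nat \<times> nat \<Rightarrow> 'a) \<Rightarrow> 'p NP_poly \<Rightarrow> 'a" where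
  "poly_val c x F = (\<Sum>m\<in>Poly_Mapping.keys F. of_nat (Poly_Mapping.lookup F m) * term_val c x m)"

lemma poly_val_0 [simp]: "poly_val c x 0 = 0"
  by (simp add: poly_val_def)

lemma poly_val_add: "poly_val c x (F + G) = poly_val c x F + poly_val c x G"
  unfolding poly_val_def
  by (rule setsum_keys_plus_distrib[where f = "\<lambda>m k. of_nat k * term_val c x m"])
    (simp_all add: distrib_right)

lemma poly_val_sum: "poly_val c x (\<Sum>j\<in>A. F j) = (\<Sum>j\<in>A. poly_val c x (F j))"
  by (induction A rule: infinite_finite_induct) (simp_all add: poly_val_add)

lemma poly_val_single: "poly_val c x (Poly_Mapping.single m k) = of_nat k * term_val c x m"
  by (simp add: poly_val_def)

lemma update_eq_add_single:
  "a \<notin> Poly_Mapping.keys f \<Longrightarrow> Poly_Mapping.update a b f = f + Poly_Mapping.single a b"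
  by (rule poly_mapping_eqI)
    (auto simp: lookup_update lookup_add lookup_single when_def in_keys_iff)

text \<open>Both sides are additive in each factor, so induction over the terms of \<open>F\<close>
  and of \<open>G\<close> reduces the claim to single terms, where adding exponents multiplies
  values.\<close>

lemma poly_val_mult:
  assumes c: "\<And>p q. c (p * q) = c p * c q"
  shows "poly_val c x (F * G) = poly_val c x F * poly_val c x G"
proof -
  have term_val_add: "term_val c x (a + b) = term_val c x a * term_val c x b" for a b
    by (cases a; cases b)
      (simp add: term_val_def plus_additive.rep_eq c mon_val_add plus_prod_def mult_ac)
  have single: "poly_val c x (Poly_Mapping.single a k * G) = poly_val c x (Poly_Mapping.single a k) * poly_val c x G"
    for a k
  proof (induction G rule: update_induct)
    case (update G b l)
    then show ?case
      by (simp add: update_eq_add_single distrib_left poly_val_add mult_single poly_val_single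
          term_val_add mult_ac)
  qed simp
  show ?thesis
  proof (induction F rule: update_induct)
    case (update F a k)
    then show ?case
      by (simp add: update_eq_add_single distrib_right poly_val_add single)
  qed simp
qed

text \<open>Variables are confined to \<open>D\<close> because injectivity needs it: for instance
  \<open>elem_sym r (i, 0)\<close> is 1.\<close>

definition NP_poly_on :: "(nat \<times> nat) set \<Rightarrow> 'p::semifield NP_poly set" where
  "NP_poly_on D = {F. \<forall>(p, \<alpha>)\<in>Poly_Mapping.keys F. Poly_Mapping.keys \<alpha> \<subseteq> D}"

lemma NP_poly_on_0: "0 \<in> NP_poly_on D"
  by (simp add: NP_poly_on_def)

lemma NP_poly_on_add: "F \<in> NP_poly_on D \<Longrightarrow> G \<in> NP_poly_on D \<Longrightarrow> F + G \<in> NP_poly_on D"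
  using keys_add[of F G] unfolding NP_poly_on_def by blast

lemma NP_poly_on_sum: "(\<And>j. j \<in> A \<Longrightarrow> F j \<in> NP_poly_on D) \<Longrightarrow> (\<Sum>j\<in>A. F j) \<in> NP_poly_on D"
  by (induction A rule: infinite_finite_induct) (auto simp: NP_poly_on_0 intro: NP_poly_on_add)

lemma NP_poly_on_single: "Poly_Mapping.keys \<alpha> \<subseteq> D \<Longrightarrow> Poly_Mapping.single (p, \<alpha>) k \<in> NP_poly_on D"
  by (simp add: NP_poly_on_def)

lemma NP_poly_on_mult:
  assumes "F \<in> NP_poly_on D" "G \<in> NP_poly_on D"
  shows "F * G \<in> NP_poly_on D"
  unfolding NP_poly_on_def
proof safe
  fix p \<alpha> d assume "(p, \<alpha>) \<in> Poly_Mapping.keys (F * G)" and d: "d \<in> Poly_Mapping.keys \<alpha>"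
  then obtain a b where ab: "(p, \<alpha>) = a + b" "a \<in> Poly_Mapping.keys F" "b \<in> Poly_Mapping.keys G"
    using keys_mult[of F G] by blast
  then have "\<alpha> = snd a + snd b" by (simp add: plus_prod_def)
  then have "d \<in> Poly_Mapping.keys (snd a) \<union> Poly_Mapping.keys (snd b)"
    using d keys_add[of "snd a" "snd b"] by auto
  then show "d \<in> D" using ab assms unfolding NP_poly_on_def by (cases a; cases b) auto
qed

section \<open>Embedding of the coefficients and the parametrization of
  \<open>NP_e n r\<close>\<close>

lemma ZP_to_QPs_eq_to_fract: "ZP_to_QPs a = to_fract (Poly_Mapping.single 0 (to_fract a))"
  by (simp add: ZP_to_QPs_def to_fract_def)

lemma ZP_to_QPs_0 [simp]: "ZP_to_QPs 0 = 0"
  and ZP_to_QPs_1 [simp]: "ZP_to_QPs 1 = 1"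
  and ZP_to_QPs_add: "ZP_to_QPs (a + b) = ZP_to_QPs a + ZP_to_QPs b"
  and ZP_to_QPs_mult: "ZP_to_QPs (a * b) = ZP_to_QPs a * ZP_to_QPs b"
  by (simp_all add: ZP_to_QPs_eq_to_fract single_add mult_single flip: to_fract_mult)

lemma ZP_to_QPs_sum: "ZP_to_QPs (\<Sum>j\<in>A. f j) = (\<Sum>j\<in>A. ZP_to_QPs (f j))"
  by (induction A rule: infinite_finite_induct) (simp_all add: ZP_to_QPs_add)

lemma ZP_to_QPs_of_nat: "ZP_to_QPs (of_nat k) = of_nat k"
  by (induction k) (simp_all add: ZP_to_QPs_add)

lemma P_to_QPs_1 [simp]: "P_to_QPs 1 = 1"
  by (simp add: P_to_QPs_def flip: zero_additive_def)

lemma P_to_QPs_mult: "P_to_QPs (p * q) = P_to_QPs p * P_to_QPs q"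
proof -
  have "add_of (p * q) = add_of p + add_of q"
    by (simp add: plus_additive.abs_eq)
  then show ?thesis
    by (simp add: P_to_QPs_def ZP_to_QPs_mult[symmetric] mult_single)
qed

lemma poly_mapping_sum_single:
  "f = (\<Sum>k\<in>Poly_Mapping.keys f. Poly_Mapping.single k (Poly_Mapping.lookup f k))"
  by (rule poly_mapping_eqI)
    (auto simp: lookup_sum lookup_single when_def in_keys_iff if_distrib sum.delta cong: if_cong)

lemma ZP_to_QPs_eq_sum:
  assumes "a \<in> NP"
  shows "ZP_to_QPs a = (\<Sum>q\<in>Poly_Mapping.keys a.
    of_nat (nat (Poly_Mapping.lookup a q)) * P_to_QPs (mult_of q))"
proof -
  have "ZP_to_QPs (Poly_Mapping.single q (Poly_Mapping.lookup a q))
      = of_nat (nat (Poly_Mapping.lookup a q)) * P_to_QPs (mult_of q)" for q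
  proof -
    have "Poly_Mapping.single q (Poly_Mapping.lookup a q)
        = of_nat (nat (Poly_Mapping.lookup a q)) * Poly_Mapping.single q 1"
      using assms by (simp add: NP_def mult_single flip: single_of_nat)
    then show ?thesis
      by (simp add: ZP_to_QPs_mult ZP_to_QPs_of_nat P_to_QPs_def mult_of_inverse)
  qed
  then show ?thesis
    by (subst poly_mapping_sum_single[of a]) (simp add: ZP_to_QPs_sum)
qed

text \<open>Lift of an element of \<open>NP\<close> to a formal polynomial without variables;
  \<open>nat\<close> loses nothing there, the coefficients being nonnegative.\<close>

definition const_poly :: "'p::semifield ZP \<Rightarrow> 'p NP_poly" where
  "const_poly a = (\<Sum>q\<in>Poly_Mapping.keys a. Poly_Mapping.single (q, 0) (nat (Poly_Mapping.lookup a q)))"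

lemma poly_val_const_poly_QPs: "a \<in> NP \<Longrightarrow> poly_val P_to_QPs x (const_poly a) = ZP_to_QPs a"
  by (simp add: const_poly_def poly_val_sum poly_val_single term_val_def ZP_to_QPs_eq_sum)

lemma poly_val_const_poly_P0: "poly_val Elt x (const_poly a) = pi_P0 a"
  by (simp add: const_poly_def poly_val_sum poly_val_single term_val_def pi_P0_def)

lemma const_poly_on: "const_poly a \<in> NP_poly_on D"
  unfolding const_poly_def by (intro NP_poly_on_sum NP_poly_on_single) simp

lemma poly_val_gen:
  "c 1 = 1 \<Longrightarrow> poly_val c x (Poly_Mapping.single (0, Poly_Mapping.single d 1) 1) = x d"
  by (simp add: poly_val_single term_val_def zero_additive.rep_eq del: One_nat_def)

lemma NP_0: "0 \<in> NP"
  and NP_single: "k \<ge> 0 \<Longrightarrow> Poly_Mapping.single q k \<in> NP"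
  by (auto simp: NP_def lookup_single when_def)

lemma NP_1: "1 \<in> NP"
  using NP_single[of 1 0] by simp

lemma NP_adjoin_0: "0 \<in> NP_adjoin X"
  using NP_adjoin.const[OF NP_0] by simp

lemma NP_adjoin_1: "1 \<in> NP_adjoin X"
  using NP_adjoin.const[OF NP_1] by simp

lemma NP_adjoin_P: "P_to_QPs p \<in> NP_adjoin X"
  unfolding P_to_QPs_def by (intro NP_adjoin.const NP_single) simp

lemma NP_adjoin_sum: "(\<And>j. j \<in> A \<Longrightarrow> f j \<in> NP_adjoin X) \<Longrightarrow> (\<Sum>j\<in>A. f j) \<in> NP_adjoin X"
  by (induction A rule: infinite_finite_induct) (auto intro: NP_adjoin_0 NP_adjoin.add)

lemma NP_adjoin_prod: "(\<And>j. j \<in> A \<Longrightarrow> f j \<in> NP_adjoin X) \<Longrightarrow> (\<Prod>j\<in>A. f j) \<in> NP_adjoin X"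
  by (induction A rule: infinite_finite_induct) (auto intro: NP_adjoin_1 NP_adjoin.mult)

lemma NP_adjoin_power: "f \<in> NP_adjoin X \<Longrightarrow> f ^ k \<in> NP_adjoin X"
  by (induction k) (auto intro: NP_adjoin_1 NP_adjoin.mult)

lemma NP_adjoin_of_nat: "of_nat k \<in> NP_adjoin X"
  by (induction k) (auto intro: NP_adjoin_0 NP_adjoin_1 NP_adjoin.add)

text \<open>The image contains the generators and is closed under sums and products; conversely
  every term is a product of generators. A function on \<open>NP_e n r\<close> can thus be
  prescribed on formal polynomials.\<close>

lemma NP_e_eq_image: "NP_e n r = poly_val P_to_QPs (elem_sym r) ` NP_poly_on (idx n r)"
proof (intro equalityI subsetI)
  fix f assume "f \<in> NP_e n r"
  then show "f \<in> poly_val P_to_QPs (elem_sym r) ` NP_poly_on (idx n r)"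
    unfolding NP_e_def
  proof (induction rule: NP_adjoin.induct)
    case (const a)
    show ?case
      by (rule image_eqI[OF _ const_poly_on[of a]]) (simp add: poly_val_const_poly_QPs const)
  next
    case (gen x)
    then obtain d where d: "d \<in> idx n r" "x = elem_sym r d" by blast
    have "Poly_Mapping.single (0, Poly_Mapping.single d 1) 1 \<in> NP_poly_on (idx n r)"
      using d by (intro NP_poly_on_single) simp
    then show ?case using d poly_val_gen[of P_to_QPs "elem_sym r" d] by (metis P_to_QPs_1 imageI)
  next
    case (add f g)
    then show ?case by (auto simp: poly_val_add[symmetric] intro: NP_poly_on_add)
  next
    case (mult f g)
    then show ?case
      by (auto simp: poly_val_mult[OF P_to_QPs_mult, symmetric] intro: NP_poly_on_mult)
  qed
next
  fix f assume "f \<in> poly_val P_to_QPs (elem_sym r) ` NP_poly_on (idx n r)"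
  then obtain F where F: "F \<in> NP_poly_on (idx n r)" "f = poly_val P_to_QPs (elem_sym r) F" by blast
  have "term_val P_to_QPs (elem_sym r) m \<in> NP_e n r"
    if "m \<in> Poly_Mapping.keys F" for m
  proof (cases m)
    case (Pair p \<alpha>)
    then have "Poly_Mapping.keys \<alpha> \<subseteq> idx n r" using that F unfolding NP_poly_on_def by auto
    then show ?thesis
      unfolding NP_e_def term_val_def mon_val_def Pair prod.case
      by (intro NP_adjoin.mult NP_adjoin_P NP_adjoin_prod NP_adjoin_power NP_adjoin.gen) auto
  qed
  then show "f \<in> NP_e n r"
    unfolding NP_e_def poly_val_def F(2)
    by (intro NP_adjoin_sum NP_adjoin.mult NP_adjoin_of_nat)
qed

section \<open>Injectivity of the parametrization and existence of \<psi>\<close>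

lemma elem_sym_terms_independent:
  fixes c :: "'p::semifield additive \<times> (nat \<times> nat \<Rightarrow>\<^sub>0 nat) \<Rightarrow> int"
  assumes fin: "finite A" and A: "\<And>p \<alpha>. (p, \<alpha>) \<in> A \<Longrightarrow> Poly_Mapping.keys \<alpha> \<subseteq> idx n r"
    and 0: "(\<Sum>m\<in>A. of_int (c m) * term_val P_to_QPs (elem_sym r) m) = 0"
    and m: "m \<in> A"
  shows "c m = 0"
proof (rule ccontr)
  assume "c m \<noteq> 0"
  \<comment> \<open>Terms with coefficient zero are dropped, so that the largest leading exponent
    \<mu> belongs to a term that really occurs.\<close>
  define A' where "A' = {m\<in>A. c m \<noteq> 0}"
  have A': "finite A'" "A' \<subseteq> A" using fin by (auto simp: A'_def)
  have "m \<in> A'" using m \<open>c m \<noteq> 0\<close> by (simp add: A'_def)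
  then have "A' \<noteq> {}" by blast
  define \<mu> where "\<mu> = Max ((\<lambda>m. lead_expo (snd m)) ` A')"
  have "\<mu> \<in> (\<lambda>m. lead_expo (snd m)) ` A'"
    unfolding \<mu>_def using A' \<open>A' \<noteq> {}\<close> by (intro Max_in) auto
  then obtain p0 \<alpha>0 where m0: "(p0, \<alpha>0) \<in> A'" "\<mu> = lead_expo \<alpha>0" by auto
  have \<mu>: "lead_expo \<alpha> \<le> \<mu>" if "(p, \<alpha>) \<in> A'" for p \<alpha>
    unfolding \<mu>_def using that A' by (intro Max_ge) force+
  \<comment> \<open>The terms as polynomials in the variables \<open>s\<close> over the fraction
    field of the group ring, where the coefficient at \<mu> makes sense.\<close>
  define T :: "'p additive \<times> (nat \<times> nat \<Rightarrow>\<^sub>0 nat) \<Rightarrow> (nat \<times> nat \<Rightarrow>\<^sub>0 nat) \<Rightarrow>\<^sub>0 'p QP"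
    where "T = (\<lambda>(p, \<alpha>). Poly_Mapping.single 0 (to_fract (Poly_Mapping.single p (c (p, \<alpha>))))
        * mon_val (elem_sym_poly r) \<alpha>)"
  have of_int_eq: "of_int k * P_to_QPs (mult_of p) = ZP_to_QPs (Poly_Mapping.single p k)"
    for k and p :: "'p additive"
  proof -
    have "ZP_to_QPs (of_int k) = (of_int k :: 'p QPs)"
    proof (cases k)
      case (neg j)
      have "ZP_to_QPs (- of_nat (Suc j)) + ZP_to_QPs (of_nat (Suc j)) = (0 :: 'p QPs)"
        unfolding ZP_to_QPs_add[symmetric] by simp
      then show ?thesis unfolding neg ZP_to_QPs_of_nat
        by (simp add: eq_neg_iff_add_eq_0 del: of_nat_Suc)
    qed (simp add: ZP_to_QPs_of_nat)
    moreover have "Poly_Mapping.single p k = of_int k * Poly_Mapping.single p 1"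
      by (simp add: mult_single flip: single_of_int)
    ultimately show ?thesis by (simp add: ZP_to_QPs_mult P_to_QPs_def mult_of_inverse)
  qed
  have "of_int (c m) * term_val P_to_QPs (elem_sym r) m = to_fract (T m)" for m
  proof (cases m)
    case (Pair p \<alpha>)
    have "mon_val (elem_sym r) \<alpha> = (to_fract (mon_val (elem_sym_poly r) \<alpha>) :: 'p QPs)"
      by (simp add: mon_val_def to_fract_prod to_fract_power elem_sym_eq_to_fract)
    then show ?thesis
      by (simp add: Pair T_def term_val_def of_int_eq ZP_to_QPs_eq_to_fract flip: mult.assoc)
  qed
  then have "to_fract (\<Sum>m\<in>A. T m) = 0" using 0 unfolding to_fract_sum by simp
  then have "(\<Sum>m\<in>A. T m) = 0" by (simp only: to_fract_eq_0_iff)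
  moreover have "(\<Sum>m\<in>A. T m) = (\<Sum>m\<in>A'. T m)"
    by (rule sum.mono_neutral_right) (auto simp: fin A'_def T_def)
  ultimately have "(\<Sum>m\<in>A'. Poly_Mapping.lookup (T m) \<mu>) = 0"
    by (simp flip: lookup_sum)
  \<comment> \<open>By injectivity of \<open>lead_expo\<close> only terms with exponent \<alpha>0
    reach \<mu>. Several group elements may accompany \<alpha>0, so the coefficient at \<mu> is an
    element of the group ring.\<close>
  moreover have "Poly_Mapping.lookup (T m) \<mu> = to_fract (if snd m = \<alpha>0 then Poly_Mapping.single (fst m) (c m) else 0)"
    if mA': "m \<in> A'" for m
  proof (cases m)
    case (Pair p \<alpha>)
    have lead: "monic_lead (mon_val (elem_sym_poly r) \<beta> :: _ \<Rightarrow>\<^sub>0 'p QP) (lead_expo \<beta>)"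
      if "(q, \<beta>) \<in> A'" for q \<beta>
      using that A'(2) A by (intro monic_lead_mon_val_elem_sym_poly) blast
    have eq: "Poly_Mapping.lookup (T m) \<mu> = to_fract (Poly_Mapping.single p (c m))
        * Poly_Mapping.lookup (mon_val (elem_sym_poly r) \<alpha>) \<mu>"
      unfolding T_def Pair prod.case by (simp flip: mult_map_scale_conv_mult add: Poly_Mapping.map.rep_eq when_def)
    show ?thesis
    proof (cases "\<alpha> = \<alpha>0")
      case True
      then show ?thesis using lead[OF m0(1)] eq by (simp add: Pair m0(2) monic_lead_def)
    next
      case False
      then have "lead_expo \<alpha> \<noteq> \<mu>"
        using inj_on_lead_expo[of n r] m0 mA' A'(2) A unfolding Pair inj_on_def by blast
      then have "lead_expo \<alpha> < \<mu>" using \<mu> mA' Pair by (simp add: order_less_le)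
      then show ?thesis
        using monic_lead_lookup_eq_0[OF lead] mA' eq False by (simp add: Pair)
    qed
  qed
  ultimately have "to_fract (\<Sum>m\<in>A'. if snd m = \<alpha>0 then Poly_Mapping.single (fst m) (c m) else 0) = (0 :: 'p QP)"
    unfolding to_fract_sum by simp
  then have "(\<Sum>m\<in>A'. if snd m = \<alpha>0 then Poly_Mapping.single (fst m) (c m) else 0) = 0"
    by (simp only: to_fract_eq_0_iff)
  \<comment> \<open>Distinct group elements are independent in the group ring, so its coefficient at
    \<open>p0\<close> isolates the single integer \<open>c (p0, \<alpha>0)\<close>.\<close>
  then have "(\<Sum>m\<in>A'. Poly_Mapping.lookup
      (if snd m = \<alpha>0 then Poly_Mapping.single (fst m) (c m) else 0) p0) = 0"
    by (simp flip: lookup_sum)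
  moreover have "Poly_Mapping.lookup (if snd m = \<alpha>0 then Poly_Mapping.single (fst m) (c m) else 0) p0
      = (if m = (p0, \<alpha>0) then c m else 0)" for m
    by (auto simp: lookup_single when_def)
  ultimately have "(\<Sum>m\<in>A'. if m = (p0, \<alpha>0) then c m else 0) = 0"
    by simp
  then have "c (p0, \<alpha>0) = 0" using A'(1) m0(1) by (simp add: sum.delta')
  then show False using m0(1) by (simp add: A'_def)
qed

text \<open>Natural coefficients cannot be subtracted, so the difference of two expressions is
  formed with integer coefficients on the union of their supports and independence is applied to
  it.\<close>

lemma inj_on_poly_val_elem_sym:
  "inj_on (poly_val P_to_QPs (elem_sym r)) (NP_poly_on (idx n r))"
proof (rule inj_onI)
  fix F G :: "'p::semifield NP_poly"
  assume F: "F \<in> NP_poly_on (idx n r)" and G: "G \<in> NP_poly_on (idx n r)"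
    and eq: "poly_val P_to_QPs (elem_sym r) F = poly_val P_to_QPs (elem_sym r) G"
  define A where "A = Poly_Mapping.keys F \<union> Poly_Mapping.keys G"
  define c where "c m = int (Poly_Mapping.lookup F m) - int (Poly_Mapping.lookup G m)" for m
  have val: "poly_val P_to_QPs (elem_sym r) H
      = (\<Sum>m\<in>A. of_nat (Poly_Mapping.lookup H m) * term_val P_to_QPs (elem_sym r) m)"
    if "Poly_Mapping.keys H \<subseteq> A" for H
    unfolding poly_val_def using that
    by (intro sum.mono_neutral_left) (auto simp: A_def in_keys_iff)
  have "(\<Sum>m\<in>A. of_int (c m) * term_val P_to_QPs (elem_sym r) m)
      = poly_val P_to_QPs (elem_sym r) F - poly_val P_to_QPs (elem_sym r) G"
    by (subst (1 2) val) (auto simp: A_def c_def left_diff_distrib sum_subtractf)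
  then have *: "(\<Sum>m\<in>A. of_int (c m) * term_val P_to_QPs (elem_sym r) m) = 0"
    using eq by simp
  have "c m = 0" if "m \<in> A" for m
    by (rule elem_sym_terms_independent[OF _ _ * that]) (use F G in \<open>auto simp: A_def NP_poly_on_def\<close>)
  then have "Poly_Mapping.lookup F m = Poly_Mapping.lookup G m" for m
    by (cases "m \<in> A") (auto simp: c_def A_def in_keys_iff)
  then show "F = G" by (rule poly_mapping_eqI)
qed

text \<open>For existence, the unique formal preimage is evaluated in the semifield with zero
  adjoined. Uniqueness follows by induction on the generation of \<open>NP_e n r\<close> together
  with extensionality outside it.\<close>

lemma psi_spec:
  fixes n r and z :: "nat \<times> nat \<Rightarrow> 'p::semifield adjoin_zero"
  defines "h \<equiv> psi n r z"
  shows "h \<in> extensional (NP_e n r) \<and>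
     (\<forall>f\<in>NP_e n r. \<forall>g\<in>NP_e n r. h (f + g) = h f + h g \<and> h (f * g) = h f * h g) \<and>
     (\<forall>a\<in>NP. h (ZP_to_QPs a) = pi_P0 a) \<and>
     (\<forall>d\<in>idx n r. h (elem_sym r d) = z d)" (is "?spec h")
proof -
  let ?\<Theta> = "poly_val P_to_QPs (elem_sym r)"
  let ?W = "NP_poly_on (idx n r) :: 'p NP_poly set"
  define k where "k = restrict (poly_val Elt z \<circ> inv_into ?W ?\<Theta>) (NP_e n r)"
  have k: "k (?\<Theta> F) = poly_val Elt z F" if "F \<in> ?W" for F
    using that by (simp add: k_def NP_e_eq_image inv_into_f_f[OF inj_on_poly_val_elem_sym])
  have spec_k: "?spec k"
  proof (intro conjI ballI)
    show "k \<in> extensional (NP_e n r)" by (simp add: k_def)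
  next
    fix f g :: "'p QPs" assume "f \<in> NP_e n r" "g \<in> NP_e n r"
    then obtain F G where FG: "f = ?\<Theta> F" "g = ?\<Theta> G" "F \<in> ?W" "G \<in> ?W"
      unfolding NP_e_eq_image by blast
    show "k (f + g) = k f + k g"
      using FG k NP_poly_on_add[OF FG(3,4)] by (metis poly_val_add)
    show "k (f * g) = k f * k g"
      using k[OF NP_poly_on_mult[OF FG(3,4)]] k[OF FG(3)] k[OF FG(4)]
      by (simp add: FG(1,2) poly_val_mult[OF P_to_QPs_mult] poly_val_mult[of Elt])
  next
    fix a :: "'p ZP" assume "a \<in> NP"
    then show "k (ZP_to_QPs a) = pi_P0 a"
      using k[OF const_poly_on[of a]] by (simp add: poly_val_const_poly_QPs poly_val_const_poly_P0)
  next
    fix d assume "d \<in> idx n r"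
    then have "Poly_Mapping.single (0, Poly_Mapping.single d 1) 1 \<in> ?W"
      by (intro NP_poly_on_single) simp
    from k[OF this] show "k (elem_sym r d) = z d"
      by (simp only: poly_val_gen P_to_QPs_1 one_adjoin_zero_def)
  qed
  have "\<exists>!h. ?spec h"
  proof (rule ex1I)
    show "?spec k" by (rule spec_k)
  next
    fix h assume h: "?spec h"
    show "h = k"
    proof (rule extensionalityI)
      show "h \<in> extensional (NP_e n r)" using h by blast
      show "k \<in> extensional (NP_e n r)" by (simp add: k_def)
    next
      fix f :: "'p QPs" assume "f \<in> NP_e n r"
      then show "h f = k f" unfolding NP_e_def
      proof (induction rule: NP_adjoin.induct)
        case (add f g)
        then show ?case using h spec_k unfolding NP_e_def by simp
      next
        case (mult f g)
        then show ?case using h spec_k unfolding NP_e_def by simp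
      qed (use h spec_k in auto)
    qed
  qed
  from theI'[OF this] show ?thesis unfolding h_def psi_def .
qed


section \<open>The homomorphism on fractions\<close>

lemma psi_add: "f \<in> NP_e n r \<Longrightarrow> g \<in> NP_e n r \<Longrightarrow> psi n r z (f + g) = psi n r z f + psi n r z g"
  and psi_mult: "f \<in> NP_e n r \<Longrightarrow> g \<in> NP_e n r \<Longrightarrow> psi n r z (f * g) = psi n r z f * psi n r z g"
  and psi_ZP: "a \<in> NP \<Longrightarrow> psi n r z (ZP_to_QPs a) = pi_P0 a"
  and psi_elem_sym: "d \<in> idx n r \<Longrightarrow> psi n r z (elem_sym r d) = z d"
  using psi_spec[of n r z] by blast+

lemma psi_0: "psi n r z 0 = 0"
  using psi_ZP[OF NP_0, of n r z] by (simp add: pi_P0_def)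

lemma psi_P: "psi n r z (P_to_QPs p) = Elt p"
  by (simp add: P_to_QPs_def psi_ZP NP_single pi_P0_def add_of_inverse)

lemma psi_1: "psi n r z 1 = 1"
  using psi_P[of n r z 1] by (simp add: one_adjoin_zero_def)

lemma Elt_neq_0 [simp]: "Elt a \<noteq> 0"
  by (simp add: zero_adjoin_zero_def)

lemma adjoin_zero_neq_0_iff: "v \<noteq> 0 \<longleftrightarrow> (\<exists>a. v = Elt a)"
  by (cases v) (auto simp: zero_adjoin_zero_def)

lemma semifield_inverse_1: "inverse 1 = (1 :: 'p::semifield)"
  by (rule semifield_inverse_unique) simp

lemma Elt_mult_inverse: "Elt a * Elt (inverse a) = 1"
  by (simp add: semifield_right_inverse one_adjoin_zero_def)

lemma Elt_power: "Elt a ^ k = Elt (a ^ k)"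
  by (induction k) (simp_all add: one_adjoin_zero_def)

text \<open>The extension of \<open>\<psi>\<close> to fractions is set up with values in \<open>\<bbbP>\<^sub>0\<close>: the \<open>e\<^sub>i\<^sub>l\<close>
  with \<open>z\<^sub>i\<^sub>l = 0\<close> do not belong to \<open>\<bbbS>\<close> but occur in sums that do.\<close>

definition psi_frac ::
    "nat \<Rightarrow> (nat \<Rightarrow> nat) \<Rightarrow> (nat \<times> nat \<Rightarrow> 'p::semifield adjoin_zero) \<Rightarrow> 'p QPs \<Rightarrow> 'p adjoin_zero \<Rightarrow> bool"
  where
  "psi_frac n r z x v \<longleftrightarrow> (\<exists>f\<in>NP_e n r. \<exists>g\<in>NP_e n r. \<exists>b.
     x = f / g \<and> psi n r z g = Elt b \<and> v = psi n r z f * Elt (inverse b))"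

text \<open>Admissible denominators are nonzero in the field, which licenses clearing them.\<close>

lemma psi_Elt_neq_0: "psi n r z g = Elt b \<Longrightarrow> g \<noteq> 0"
  using psi_0 by (metis Elt_neq_0)

text \<open>Cross-multiplying gives \<open>f * g' = f' * g\<close>; applying \<psi> and cancelling
  the invertible values \<open>Elt b\<close> and \<open>Elt b'\<close> yields equal values.\<close>

lemma psi_frac_unique:
  assumes "psi_frac n r z x v" "psi_frac n r z x w"
  shows "v = w"
proof -
  obtain f g b where 1: "f \<in> NP_e n r" "g \<in> NP_e n r" "x = f / g" "psi n r z g = Elt b"
      "v = psi n r z f * Elt (inverse b)"
    using assms(1) unfolding psi_frac_def by blast
  obtain f' g' b' where 2: "f' \<in> NP_e n r" "g' \<in> NP_e n r" "x = f' / g'" "psi n r z g' = Elt b'"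
      "w = psi n r z f' * Elt (inverse b')"
    using assms(2) unfolding psi_frac_def by blast
  have "f * g' = f' * g"
    using 1(3) 2(3) psi_Elt_neq_0[OF 1(4)] psi_Elt_neq_0[OF 2(4)] by (simp add: frac_eq_eq)
  then have eq: "psi n r z f * Elt b' = psi n r z f' * Elt b"
    using psi_mult[OF 1(1) 2(2), of z] psi_mult[OF 2(1) 1(2), of z] 1(4) 2(4) by simp
  have "v = (psi n r z f * Elt b') * (Elt (inverse b') * Elt (inverse b))"
    unfolding 1(5) using Elt_mult_inverse[of b'] by (metis mult.assoc mult.right_neutral mult.commute)
  also have "\<dots> = psi n r z f' * (Elt b * Elt (inverse b)) * Elt (inverse b')"
    unfolding eq by (simp only: mult_ac)
  also have "\<dots> = w" by (simp add: 2(5) Elt_mult_inverse del: times_adjoin_zero.simps)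
  finally show ?thesis .
qed

lemma psi_frac_NP_e: "f \<in> NP_e n r \<Longrightarrow> psi_frac n r z f (psi n r z f)"
  unfolding psi_frac_def
proof (intro bexI exI conjI)
  show "psi n r z 1 = Elt 1" by (simp add: psi_1 one_adjoin_zero_def)
  show "psi n r z f = psi n r z f * Elt (inverse 1)"
    by (simp add: semifield_inverse_1 flip: one_adjoin_zero_def)
  show "1 \<in> NP_e n r" by (simp add: NP_e_def NP_adjoin_1)
qed simp_all

lemma psi_frac_P: "psi_frac n r z (P_to_QPs p) (Elt p)"
  using psi_frac_NP_e[of "P_to_QPs p" n r z] by (simp add: NP_e_def NP_adjoin_P psi_P)

lemma psi_frac_0: "psi_frac n r z 0 0"
  using psi_frac_NP_e[of 0 n r z] by (simp add: NP_e_def NP_adjoin_0 psi_0)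

lemma psi_frac_1: "psi_frac n r z 1 1"
  using psi_frac_NP_e[of 1 n r z] by (simp add: NP_e_def NP_adjoin_1 psi_1)

lemma psi_frac_mult:
  assumes "psi_frac n r z x v" "psi_frac n r z y w"
  shows "psi_frac n r z (x * y) (v * w)"
proof -
  obtain f g b where 1: "f \<in> NP_e n r" "g \<in> NP_e n r" "x = f / g" "psi n r z g = Elt b"
      "v = psi n r z f * Elt (inverse b)"
    using assms(1) unfolding psi_frac_def by blast
  obtain f' g' b' where 2: "f' \<in> NP_e n r" "g' \<in> NP_e n r" "y = f' / g'" "psi n r z g' = Elt b'"
      "w = psi n r z f' * Elt (inverse b')"
    using assms(2) unfolding psi_frac_def by blast
  show ?thesis
    unfolding psi_frac_def
  proof (intro bexI exI conjI)
    show "x * y = (f * f') / (g * g')" by (simp add: 1(3) 2(3))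
    show "psi n r z (g * g') = Elt (b * b')" using 1 2 by (simp add: psi_mult)
    have "Elt (inverse (b * b')) = Elt (inverse b) * Elt (inverse b')"
      by (simp add: semifield_inverse_mult)
    then show "v * w = psi n r z (f * f') * Elt (inverse (b * b'))"
      unfolding psi_mult[OF 1(1) 2(1)] 1(5) 2(5) by (simp only: mult_ac)
    show "f * f' \<in> NP_e n r" "g * g' \<in> NP_e n r"
      using 1 2 by (auto simp: NP_e_def intro: NP_adjoin.mult)
  qed
qed

lemma psi_frac_add:
  assumes "psi_frac n r z x v" "psi_frac n r z y w"
  shows "psi_frac n r z (x + y) (v + w)"
proof -
  obtain f g b where 1: "f \<in> NP_e n r" "g \<in> NP_e n r" "x = f / g" "psi n r z g = Elt b"
      "v = psi n r z f * Elt (inverse b)"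
    using assms(1) unfolding psi_frac_def by blast
  obtain f' g' b' where 2: "f' \<in> NP_e n r" "g' \<in> NP_e n r" "y = f' / g'" "psi n r z g' = Elt b'"
      "w = psi n r z f' * Elt (inverse b')"
    using assms(2) unfolding psi_frac_def by blast
  have in_NP: "f * g' \<in> NP_e n r" "f' * g \<in> NP_e n r" "g * g' \<in> NP_e n r"
      "f * g' + f' * g \<in> NP_e n r"
    using 1 2 by (auto simp: NP_e_def intro: NP_adjoin.mult NP_adjoin.add)
  show ?thesis
    unfolding psi_frac_def
  proof (intro bexI exI conjI)
    show "x + y = (f * g' + f' * g) / (g * g')"
      using psi_Elt_neq_0[OF 1(4)] psi_Elt_neq_0[OF 2(4)] by (simp add: 1(3) 2(3) add_frac_eq)
    show "psi n r z (g * g') = Elt (b * b')" using 1 2 by (simp add: psi_mult)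
    have inv: "Elt (inverse (b * b')) = Elt (inverse b) * Elt (inverse b')"
      by (simp add: semifield_inverse_mult)
    have "psi n r z (f * g' + f' * g) * Elt (inverse (b * b'))
        = psi n r z f * Elt (inverse b) * (Elt b' * Elt (inverse b'))
        + psi n r z f' * Elt (inverse b') * (Elt b * Elt (inverse b))"
      unfolding psi_add[OF in_NP(1,2)] psi_mult[OF 1(1) 2(2)] psi_mult[OF 2(1) 1(2)] 1(4) 2(4) inv
      by (simp only: distrib_left distrib_right mult_ac)
    then show "v + w = psi n r z (f * g' + f' * g) * Elt (inverse (b * b'))"
      by (simp add: 1(5) 2(5) Elt_mult_inverse del: times_adjoin_zero.simps)
  qed (use in_NP in auto)
qed

text \<open>A nonzero value of the fraction forces a nonzero value of its numerator, which may then
  serve as a denominator.\<close>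

lemma psi_frac_inverse:
  assumes "psi_frac n r z x (Elt a)"
  shows "psi_frac n r z (inverse x) (Elt (inverse a))"
proof -
  obtain f g b where 1: "f \<in> NP_e n r" "g \<in> NP_e n r" "x = f / g" "psi n r z g = Elt b"
      "Elt a = psi n r z f * Elt (inverse b)"
    using assms(1) unfolding psi_frac_def by blast
  then obtain c where c: "psi n r z f = Elt c" by (cases "psi n r z f") auto
  then have a: "a = c * inverse b" using 1(5) by simp
  show ?thesis
    unfolding psi_frac_def
  proof (intro bexI exI conjI)
    show "inverse x = g / f" by (simp add: 1(3))
    show "psi n r z f = Elt c" by (rule c)
    show "Elt (inverse a) = psi n r z g * Elt (inverse c)"
      by (simp add: 1(4) a semifield_inverse_mult semifield_inverse_inverse mult.commute)
  qed (use 1 in auto)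
qed

lemma psi_frac_power: "psi_frac n r z x v \<Longrightarrow> psi_frac n r z (x ^ k) (v ^ k)"
  by (induction k) (auto intro: psi_frac_1 psi_frac_mult)

lemma psi_frac_power_int:
  "psi_frac n r z x (Elt a) \<Longrightarrow> psi_frac n r z (x powi k) (Elt (a powi k))"
  unfolding power_int_def
  using psi_frac_power[of n r z x "Elt a"] psi_frac_power[OF psi_frac_inverse, of n r z x a]
  by (simp add: Elt_power)

lemma psi_frac_sum:
  "(\<And>j. j \<in> A \<Longrightarrow> psi_frac n r z (f j) (v j)) \<Longrightarrow> psi_frac n r z (\<Sum>j\<in>A. f j) (\<Sum>j\<in>A. v j)"
  by (induction A rule: infinite_finite_induct) (auto intro: psi_frac_0 psi_frac_add)


section \<open>The quotient \<open>\<bbbS>/\<sim>\<close>\<close>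

lemma elem_sym_in_NP_adjoin:
  assumes "(i, l) \<in> idx n r"
  shows "elem_sym r (i, l) \<in> NP_adjoin (s_var ` idx n r)"
  unfolding elem_sym_def prod.case
  using assms by (intro NP_adjoin_sum NP_adjoin_prod NP_adjoin.gen imageI) (auto simp: idx_def)

lemma NP_e_subset: "NP_e n r \<subseteq> NP_adjoin (s_var ` idx n r)"
proof
  fix f assume "f \<in> NP_e n r"
  then show "f \<in> NP_adjoin (s_var ` idx n r)" unfolding NP_e_def
    by induction (auto intro: NP_adjoin.intros elem_sym_in_NP_adjoin)
qed

text \<open>Having a nonzero value is the convenient form of membership: sums, products and inverses
  are handled by the rules for \<open>psi_frac\<close>.\<close>

lemma S_semi_iff: "x \<in> S_semi n r z \<longleftrightarrow> (\<exists>a. psi_frac n r z x (Elt a))"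
proof
  assume "x \<in> S_semi n r z"
  then obtain f g where "x = f / g" "f \<in> NP_e n r" "g \<in> NP_e n r" "psi n r z f \<noteq> 0" "psi n r z g \<noteq> 0"
    unfolding S_semi_def by blast
  moreover from this(4,5) obtain a b where "psi n r z f = Elt a" "psi n r z g = Elt b"
    unfolding adjoin_zero_neq_0_iff by blast
  ultimately show "\<exists>a. psi_frac n r z x (Elt a)"
    unfolding psi_frac_def by (metis times_adjoin_zero.simps(3))
next
  assume "\<exists>a. psi_frac n r z x (Elt a)"
  then obtain a f g b where x: "f \<in> NP_e n r" "g \<in> NP_e n r" "x = f / g" "psi n r z g = Elt b"
      "Elt a = psi n r z f * Elt (inverse b)"
    unfolding psi_frac_def by blast
  then have nz: "psi n r z f \<noteq> 0" "psi n r z g \<noteq> 0" by auto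
  then have "f \<noteq> 0" "g \<noteq> 0" using psi_0 by metis+
  then have "x \<in> P_bar n r" using x NP_e_subset unfolding P_bar_def by blast
  then show "x \<in> S_semi n r z" unfolding S_semi_def using x nz by blast
qed

lemma psi_S_eq:
  assumes "psi_frac n r z x (Elt a)"
  shows "psi_S n r z x = a"
proof -
  have iff: "(\<exists>f\<in>NP_e n r. \<exists>g\<in>NP_e n r. \<exists>a b.
      x = f / g \<and> psi n r z f = Elt a \<and> psi n r z g = Elt b \<and> p = a / b) \<longleftrightarrow> psi_frac n r z x (Elt p)"
    for p
  proof
    assume "psi_frac n r z x (Elt p)"
    then obtain f g b where x: "f \<in> NP_e n r" "g \<in> NP_e n r" "x = f / g" "psi n r z g = Elt b"
      "Elt p = psi n r z f * Elt (inverse b)"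
      unfolding psi_frac_def by blast
    moreover from this obtain c where "psi n r z f = Elt c" by (cases "psi n r z f") auto
    ultimately show "\<exists>f\<in>NP_e n r. \<exists>g\<in>NP_e n r. \<exists>a b.
      x = f / g \<and> psi n r z f = Elt a \<and> psi n r z g = Elt b \<and> p = a / b"
      unfolding semifield_divide_inverse by (metis adjoin_zero.inject times_adjoin_zero.simps(3))
  qed (fastforce simp: psi_frac_def semifield_divide_inverse)
  show ?thesis
    unfolding psi_S_def iff using assms
    by (rule the_equality) (use psi_frac_unique[OF assms] in blast)
qed

text \<open>Classes are the fibres of \<psi>, so computations in the quotient reduce to computations
  with values in the semifield.\<close>

lemma S_class_eq:
  assumes "psi_frac n r z x (Elt a)"
  shows "S_class n r z x = {y. psi_frac n r z y (Elt a)}"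
proof -
  have "y \<in> S_class n r z x \<longleftrightarrow> psi_frac n r z y (Elt a)" for y
    unfolding S_class_def S_sim_def using assms
    by (auto simp: S_semi_iff psi_S_eq[OF assms]) (auto simp: psi_S_eq)
  then show ?thesis by blast
qed

lemma S_class_eq_iff:
  assumes "psi_frac n r z x (Elt a)" "psi_frac n r z y (Elt b)"
  shows "S_class n r z x = S_class n r z y \<longleftrightarrow> a = b"
  using assms psi_frac_unique[OF assms(1)] unfolding S_class_eq[OF assms(1)] S_class_eq[OF assms(2)]
  by blast

lemma carrier_S_quot: "carrier (S_quot n r z) = S_class n r z ` S_semi n r z"
  by (auto simp: S_quot_def quotient_def S_class_def)

lemma S_class_mult:
  assumes "psi_frac n r z x (Elt a)" "psi_frac n r z y (Elt b)"
  shows "S_class n r z x \<otimes>\<^bsub>S_quot n r z\<^esub> S_class n r z y = S_class n r z (x * y)"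
proof -
  have "S_class n r z (f * g) = S_class n r z (x * y)"
    if "f \<in> S_class n r z x" "g \<in> S_class n r z y" for f g
  proof -
    have "psi_frac n r z f (Elt a)" "psi_frac n r z g (Elt b)"
      using that by (auto simp: S_class_eq[OF assms(1)] S_class_eq[OF assms(2)])
    then show ?thesis
      using psi_frac_mult[of n r z] assms
      by (metis S_class_eq times_adjoin_zero.simps(3))
  qed
  then have "S_class n r z x \<otimes>\<^bsub>S_quot n r z\<^esub> S_class n r z y
      = (\<Union>f\<in>S_class n r z x. \<Union>g\<in>S_class n r z y. S_class n r z (x * y))"
    unfolding S_quot_def by (simp cong: SUP_cong)
  \<comment> \<open>A union of a constant over an empty class would be empty, so both classes must
    be inhabited.\<close>
  moreover have "S_class n r z x \<noteq> {}" "S_class n r z y \<noteq> {}"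
    unfolding S_class_eq[OF assms(1)] S_class_eq[OF assms(2)] using assms by blast+
  ultimately show ?thesis by simp
qed

section \<open>Powers and roots of classes\<close>

lemma S_class_pow:
  assumes "psi_frac n r z x (Elt a)"
  shows "S_class n r z x [^]\<^bsub>S_quot n r z\<^esub> (k::nat) = S_class n r z (x ^ k)"
proof (induction k)
  case 0
  show ?case by (simp add: S_quot_def)
next
  case (Suc k)
  then show ?case
    using S_class_mult[OF psi_frac_power[OF assms, unfolded Elt_power] assms]
    by (simp add: mult.commute)
qed

lemma semifield_power_eq_imp_eq:
  fixes a b :: "'p::semifield"
  assumes "a ^ k = b ^ k" "k > 0"
  shows "a = b"
proof -
  have "(b / a) ^ k = 1"
    using assms(1)
    by (simp add: semifield_divide_inverse power_mult_distrib semifield_right_inverse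
        flip: semifield_inverse_power)
  then have "b / a = 1" using assms(2) by (rule semifield_torsion_free)
  then show ?thesis by (rule semifield_quotient_eq_1)
qed

text \<open>A root is the class of some element with value \<open>b\<close>, and
  \<open>b ^ k = a ^ k\<close> forces \<open>b = a\<close> since semifields are
  torsion-free.\<close>

lemma is_nth_root_S_quot_iff:
  assumes y: "psi_frac n r z y (Elt (a ^ k))" and x: "psi_frac n r z x (Elt a)" and k: "k > 0"
  shows "is_nth_root (S_quot n r z) k (S_class n r z y) X \<longleftrightarrow> X = S_class n r z x"
proof
  assume "is_nth_root (S_quot n r z) k (S_class n r z y) X"
  then have root: "X \<in> S_class n r z ` S_semi n r z" "X [^]\<^bsub>S_quot n r z\<^esub> k = S_class n r z y"
    by (simp_all add: is_nth_root_def carrier_S_quot)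
  from root(1) obtain w where "w \<in> S_semi n r z" "X = S_class n r z w" by blast
  moreover from this(1) obtain b where "psi_frac n r z w (Elt b)" unfolding S_semi_iff by blast
  ultimately have w: "psi_frac n r z w (Elt b)" "X = S_class n r z w"
      "S_class n r z w [^]\<^bsub>S_quot n r z\<^esub> k = S_class n r z y"
    using root(2) by simp_all
  then have "b ^ k = a ^ k"
    using S_class_eq_iff[OF psi_frac_power[OF w(1), of k, unfolded Elt_power] y]
    by (simp add: S_class_pow[OF w(1)])
  then show "X = S_class n r z x"
    using semifield_power_eq_imp_eq[OF _ k] w S_class_eq_iff[OF w(1) x] by blast
next
  assume X: "X = S_class n r z x"
  have "S_class n r z (x ^ k) = S_class n r z y"
    using S_class_eq_iff[OF psi_frac_power[OF x, of k, unfolded Elt_power] y] by simp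
  then show "is_nth_root (S_quot n r z) k (S_class n r z y) X"
    using x unfolding is_nth_root_def carrier_S_quot X
    by (auto simp: S_class_pow S_semi_iff intro!: imageI)
qed


section \<open>Composite mutations\<close>

lemma skew_symmetrizable_diag:
  assumes "skew_symmetrizable I B" "k \<in> I"
  shows "B (k, k) = 0"
proof -
  obtain d where "d k > 0" "d k * B (k, k) = - (d k * B (k, k))"
    using assms unfolding skew_symmetrizable_def by blast
  then show ?thesis by simp
qed

text \<open>State after the first \<open>L\<close> mutations in block \<open>k\<close>. Since
  \<open>b (k, k) = 0\<close>, these mutations do not disturb one another: each inverts its own
  coefficient, negates its own row and column, and adds the same correction elsewhere.\<close>

lemma fold_mutate_ord:
  fixes y :: "nat \<times> nat \<Rightarrow> 'a::field"
  assumes k: "k \<in> {1..n}" and L: "L \<le> r k"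
    and B: "\<And>d d'. d \<in> idx n r \<Longrightarrow> d' \<in> idx n r \<Longrightarrow> oB \<Sigma> (d, d') = b (fst d, fst d')"
    and b: "b (k, k) = 0"
  defines "\<Sigma>' \<equiv> fold (\<lambda>l. mutate_ord (idx n r) (k, l)) [1..<Suc L] \<Sigma>"
  shows "(\<forall>(i, l)\<in>idx n r. oy \<Sigma>' (i, l) =
      (if i = k then if l \<le> L then inverse (oy \<Sigma> (k, l)) else oy \<Sigma> (k, l)
       else oy \<Sigma> (i, l) * (\<Prod>m=1..L. oy \<Sigma> (k, m) ^ nat (max (b (k, i)) 0)
              * (1 + oy \<Sigma> (k, m)) powi (- b (k, i))))) \<and>
    (\<forall>(i, l)\<in>idx n r. \<forall>(j, m)\<in>idx n r. oB \<Sigma>' ((i, l), (j, m)) =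
      (if i = k then if l \<le> L then - b (k, j) else b (k, j)
       else if j = k then if m \<le> L then - b (i, k) else b (i, k)
       else b (i, j) + int L * (b (i, k) * max (b (k, j)) 0 + max (- b (i, k)) 0 * b (k, j))))"
  using L unfolding \<Sigma>'_def
proof (induction L)
  case 0
  show ?case using B by (auto simp: idx_def)
next
  case (Suc L)
  define \<Sigma>1 where "\<Sigma>1 = fold (\<lambda>l. mutate_ord (idx n r) (k, l)) [1..<Suc L] \<Sigma>"
  have upt: "[1..<Suc (Suc L)] = [1..<Suc L] @ [Suc L]" by simp
  have kL: "(k, Suc L) \<in> idx n r" using k Suc.prems by (simp add: idx_def)
  have y1: "oy \<Sigma>1 (i, l) =
      (if i = k then if l \<le> L then inverse (oy \<Sigma> (k, l)) else oy \<Sigma> (k, l)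
       else oy \<Sigma> (i, l) * (\<Prod>m=1..L. oy \<Sigma> (k, m) ^ nat (max (b (k, i)) 0)
              * (1 + oy \<Sigma> (k, m)) powi (- b (k, i))))" if "(i, l) \<in> idx n r" for i l
    using Suc that unfolding \<Sigma>1_def by fastforce
  have B1: "oB \<Sigma>1 ((i, l), (j, m)) =
      (if i = k then if l \<le> L then - b (k, j) else b (k, j)
       else if j = k then if m \<le> L then - b (i, k) else b (i, k)
       else b (i, j) + int L * (b (i, k) * max (b (k, j)) 0 + max (- b (i, k)) 0 * b (k, j)))"
    if "(i, l) \<in> idx n r" "(j, m) \<in> idx n r" for i l j m
    using Suc that unfolding \<Sigma>1_def by fastforce
  have S': "fold (\<lambda>l. mutate_ord (idx n r) (k, l)) [1..<Suc (Suc L)] \<Sigma> = mutate_ord (idx n r) (k, Suc L) \<Sigma>1"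
    unfolding upt \<Sigma>1_def by simp
  show ?case
    unfolding S'
  proof (intro conjI ballI; clarify)
    fix i l assume il: "(i, l) \<in> idx n r"
    \<comment> \<open>Coefficient and matrix row at \<open>(k, Suc L)\<close> are still the initial
      ones, so this mutation supplies exactly the factor \<open>m = Suc L\<close>.\<close>
    have "oy (mutate_ord (idx n r) (k, Suc L) \<Sigma>1) (i, l) =
        (if (i, l) = (k, Suc L) then inverse (oy \<Sigma> (k, Suc L))
         else oy \<Sigma>1 (i, l) * oy \<Sigma> (k, Suc L) ^ nat (max (if i = k then 0 else b (k, i)) 0)
            * (1 + oy \<Sigma> (k, Suc L)) powi - (if i = k then 0 else b (k, i)))"
      using il kL b by (simp add: mutate_ord_def mutate_y_def y1[OF kL] B1[OF kL il])
    with y1[OF il] show "oy (mutate_ord (idx n r) (k, Suc L) \<Sigma>1) (i, l) =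
      (if i = k then if l \<le> Suc L then inverse (oy \<Sigma> (k, l)) else oy \<Sigma> (k, l)
       else oy \<Sigma> (i, l) * (\<Prod>m=1..Suc L. oy \<Sigma> (k, m) ^ nat (max (b (k, i)) 0)
              * (1 + oy \<Sigma> (k, m)) powi (- b (k, i))))"
      by (auto simp: mult_ac)
  next
    fix i l j m assume il: "(i, l) \<in> idx n r" and jm: "(j, m) \<in> idx n r"
    have "oB (mutate_ord (idx n r) (k, Suc L) \<Sigma>1) ((i, l), (j, m)) =
      (if (i, l) = (k, Suc L) \<or> (j, m) = (k, Suc L) then - oB \<Sigma>1 ((i, l), (j, m))
       else oB \<Sigma>1 ((i, l), (j, m)) + (oB \<Sigma>1 ((i, l), (k, Suc L)) * max (oB \<Sigma>1 ((k, Suc L), (j, m))) 0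
          + max (- oB \<Sigma>1 ((i, l), (k, Suc L))) 0 * oB \<Sigma>1 ((k, Suc L), (j, m))))"
      using il jm by (simp add: mutate_ord_def mutate_matrix_def)
    \<comment> \<open>For the remaining entries with an index in block \<open>k\<close> the
      correction contains a factor \<open>b (k, k)\<close> up to sign and vanishes.\<close>
    then show "oB (mutate_ord (idx n r) (k, Suc L) \<Sigma>1) ((i, l), (j, m)) =
      (if i = k then if l \<le> Suc L then - b (k, j) else b (k, j)
       else if j = k then if m \<le> Suc L then - b (i, k) else b (i, k)
       else b (i, j) + int (Suc L) * (b (i, k) * max (b (k, j)) 0 + max (- b (i, k)) 0 * b (k, j)))"
      unfolding B1[OF il jm] B1[OF il kL] B1[OF kL jm]
      using b by (auto simp: algebra_simps)
  qed
qed

section \<open>Products over one block of variables\<close>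

lemma sum_Elt_nonzero:
  assumes "finite A" "a \<in> A" "f a \<noteq> 0"
  shows "(\<Sum>x\<in>A. f x :: 'p::semifield adjoin_zero) \<noteq> 0"
proof -
  have "v \<noteq> 0 \<Longrightarrow> v + w \<noteq> 0" for v w :: "'p adjoin_zero"
    by (cases v; cases w) (auto simp: zero_adjoin_zero_def)
  then show ?thesis using assms by (subst sum.remove[of A a]) auto
qed

lemma prod_inverse: "(\<Prod>x\<in>A. inverse (f x)) = inverse (\<Prod>x\<in>A. f x :: 'a::field)"
  using prod_inversef[of f A] by (simp add: o_def)

text \<open>Expanding the product gives a sum over subsets of \<open>{1..r i}\<close>; grouping them
  by cardinality produces the elementary symmetric polynomials.\<close>

lemma prod_one_plus_s_var:
  "(\<Prod>m=1..r i. 1 + s_var (i, m) * Q) = (\<Sum>l\<le>r i. elem_sym r (i, l) * Q ^ l)"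
proof -
  have "(\<Prod>m=1..r i. 1 + s_var (i, m) * Q)
      = (\<Sum>A\<in>Pow {1..r i}. (\<Prod>m\<in>A. s_var (i, m)) * Q ^ card A)"
    by (subst add.commute) (simp add: prod_add prod.distrib)
  also have "\<dots> = (\<Sum>l\<le>r i. \<Sum>A | A \<in> Pow {1..r i} \<and> card A = l. (\<Prod>m\<in>A. s_var (i, m)) * Q ^ card A)"
  proof (rule sum.group[symmetric])
    show "card ` Pow {1..r i} \<subseteq> {..r i}"
      using card_mono[of "{1..r i}"] by auto
  qed auto
  also have "\<dots> = (\<Sum>l\<le>r i. elem_sym r (i, l) * Q ^ l)"
    by (simp add: elem_sym_def sum_distrib_right)
  finally show ?thesis .
qed

lemma prod_s_var: "(\<Prod>m=1..r i. s_var (i, m)) = elem_sym r (i, r i)"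
proof -
  have "{A. A \<subseteq> {1..r i} \<and> card A = r i} = {{1..r i}}"
    using card_subset_eq[of "{1..r i}"] by auto
  then show ?thesis by (simp add: elem_sym_def)
qed

lemma elem_sym_0: "elem_sym r (i, 0) = 1"
proof -
  have "{A. A \<subseteq> {1..r i} \<and> card A = 0} = {{}}"
    using finite_subset[of _ "{1..r i}"] by auto
  then show ?thesis by (simp add: elem_sym_def)
qed

lemma s_var_neq_0: "s_var d \<noteq> 0"
  by (simp add: s_var_def flip: to_fract_def) (metis lookup_single_eq lookup_zero zero_neq_one)

text \<open>Includes \<open>l = 0\<close>, an index outside \<open>idx n r\<close>, where the
  polynomial is 1 and the normalization of \<open>z\<close> supplies the value.\<close>

lemma psi_frac_elem_sym:
  assumes "i \<in> {1..n}" "l \<le> r i" "z (i, 0) = 1"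
  shows "psi_frac n r z (elem_sym r (i, l)) (z (i, l))"
proof (cases "l = 0")
  case False
  then have d: "(i, l) \<in> idx n r" using assms by (auto simp: idx_def)
  then have "elem_sym r (i, l) \<in> NP_e n r"
    unfolding NP_e_def by (intro NP_adjoin.gen imageI)
  from psi_frac_NP_e[OF this, of z] show ?thesis by (simp add: psi_elem_sym[OF d])
qed (use assms(3) in \<open>simp add: elem_sym_0 psi_frac_1\<close>)

section \<open>The invariant relating the two patterns\<close>

text \<open>One \<open>Q\<close> serves all \<open>l\<close>. Each alternative ties the form of the
  coefficients to the order of the exchange coefficients, which are compared only through their
  images under \<open>pi_P0\<close>.\<close>

definition coeff_matches ::
    "nat \<Rightarrow> (nat \<Rightarrow> nat) \<Rightarrow> (nat \<times> nat \<Rightarrow> 'p adjoin_zero) \<Rightarrow> 'p::semifield \<Rightarrow> 'p ZP poly \<Rightarrow>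
     (nat \<times> nat \<Rightarrow> 'p QPs) \<Rightarrow> nat \<Rightarrow> bool" where
  "coeff_matches n r z y Z Y i \<longleftrightarrow> (\<exists>Q. psi_frac n r z Q (Elt y) \<and>
     ((\<forall>l\<in>{1..r i}. Y (i, l) = s_var (i, l) * Q) \<and>
        (\<forall>l\<le>r i. pi_P0 (coeff Z l) = z (i, l)) \<or>
      (\<forall>l\<in>{1..r i}. Y (i, l) = inverse (s_var (i, l)) * Q) \<and>
        (\<forall>l\<le>r i. pi_P0 (coeff Z l) = z (i, r i - l))))"

text \<open>The variables contribute the top elementary symmetric polynomial or its inverse, both of
  value 1.\<close>

lemma coeff_matches_prod:
  assumes i: "i \<in> {1..n}" and z: "z (i, 0) = 1" "z (i, r i) = 1"
    and Y: "coeff_matches n r z y Z Y i"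
  shows "psi_frac n r z (\<Prod>l=1..r i. Y (i, l)) (Elt (y ^ r i))"
proof -
  obtain Q where Q: "psi_frac n r z Q (Elt y)"
    and Y: "(\<forall>l\<in>{1..r i}. Y (i, l) = s_var (i, l) * Q) \<or>
      (\<forall>l\<in>{1..r i}. Y (i, l) = inverse (s_var (i, l)) * Q)"
    using Y unfolding coeff_matches_def by blast
  have e: "psi_frac n r z (elem_sym r (i, r i)) (Elt 1)"
    using psi_frac_elem_sym[where z = z and r = r and l = "r i", OF i _ z(1)] z(2) by (simp add: one_adjoin_zero_def)
  from Y show ?thesis
  proof
    assume "\<forall>l\<in>{1..r i}. Y (i, l) = s_var (i, l) * Q"
    then have "(\<Prod>l=1..r i. Y (i, l)) = elem_sym r (i, r i) * Q ^ r i"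
      by (simp add: prod.distrib flip: prod_s_var)
    then show ?thesis using psi_frac_mult[OF e psi_frac_power[OF Q]] by (simp add: Elt_power)
  next
    assume "\<forall>l\<in>{1..r i}. Y (i, l) = inverse (s_var (i, l)) * Q"
    then have "(\<Prod>l=1..r i. Y (i, l)) = inverse (elem_sym r (i, r i)) * Q ^ r i"
      by (simp add: prod.distrib prod_inverse flip: prod_s_var)
    then show ?thesis using psi_frac_mult[OF psi_frac_inverse[OF e] psi_frac_power[OF Q]]
      by (simp add: Elt_power semifield_inverse_1)
  qed
qed

lemma coeff_matches_prod_one_plus:
  assumes i: "i \<in> {1..n}" and z: "z (i, 0) = 1" "z (i, r i) = 1" and deg: "degree Z = r i"
    and Y: "coeff_matches n r z y Z Y i"
  shows "psi_frac n r z (\<Prod>l=1..r i. 1 + Y (i, l)) (Elt (eval_P0 Z y))"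
proof -
  let ?v = "\<Sum>l\<le>r i. pi_P0 (coeff Z l) * Elt y ^ l"
  obtain Q where Q: "psi_frac n r z Q (Elt y)"
    and Y: "(\<forall>l\<in>{1..r i}. Y (i, l) = s_var (i, l) * Q) \<and>
        (\<forall>l\<le>r i. pi_P0 (coeff Z l) = z (i, l)) \<or>
      (\<forall>l\<in>{1..r i}. Y (i, l) = inverse (s_var (i, l)) * Q) \<and>
        (\<forall>l\<le>r i. pi_P0 (coeff Z l) = z (i, r i - l))"
    using Y unfolding coeff_matches_def by blast
  have "pi_P0 (coeff Z 0) = 1" using Y z by auto
  \<comment> \<open>The constant term is 1 in both alternatives, so \<open>unElt\<close> in
    \<open>eval_P0\<close> is applied to a genuine element.\<close>
  then have "?v \<noteq> 0"
    by (intro sum_Elt_nonzero[of _ 0]) auto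
  then obtain w where w: "?v = Elt w" unfolding adjoin_zero_neq_0_iff by blast
  have Q0: "Q \<noteq> 0"
    using psi_frac_unique[OF Q, of 0] psi_frac_0[of n r z] by (auto simp: zero_adjoin_zero_def)
  have e: "psi_frac n r z (elem_sym r (i, l)) (z (i, l))" if "l \<le> r i" for l
    using psi_frac_elem_sym[where z = z and r = r, OF i that z(1)] .
  from Y have "psi_frac n r z (\<Prod>l=1..r i. 1 + Y (i, l)) ?v"
  proof
    assume Y: "(\<forall>l\<in>{1..r i}. Y (i, l) = s_var (i, l) * Q) \<and>
        (\<forall>l\<le>r i. pi_P0 (coeff Z l) = z (i, l))"
    then have "(\<Prod>l=1..r i. 1 + Y (i, l)) = (\<Sum>l\<le>r i. elem_sym r (i, l) * Q ^ l)"
      by (simp flip: prod_one_plus_s_var)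
    moreover have "?v = (\<Sum>l\<le>r i. z (i, l) * Elt y ^ l)" using Y by simp
    ultimately show ?thesis
      using e Q by (auto intro!: psi_frac_sum psi_frac_mult psi_frac_power)
  next
    assume Y: "(\<forall>l\<in>{1..r i}. Y (i, l) = inverse (s_var (i, l)) * Q) \<and>
        (\<forall>l\<le>r i. pi_P0 (coeff Z l) = z (i, r i - l))"
    \<comment> \<open>The identity \<open>1 + Q / s = (1 + s / Q) * (Q / s)\<close> reduces the
      inverted case to the expansion at \<open>inverse Q\<close>.\<close>
    have "(\<Prod>l=1..r i. 1 + Y (i, l))
        = (\<Prod>l=1..r i. (1 + s_var (i, l) * inverse Q) * (inverse (s_var (i, l)) * Q))"
      using Y by (intro prod.cong) (auto simp: field_simps Q0 s_var_neq_0)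
    also have "\<dots> = (\<Sum>l\<le>r i. elem_sym r (i, l) * inverse Q ^ l)
        * (inverse (elem_sym r (i, r i)) * Q ^ r i)"
      unfolding prod.distrib prod_one_plus_s_var prod_inverse prod_s_var by simp
    finally have eq: "(\<Prod>l=1..r i. 1 + Y (i, l)) = (\<Sum>l\<le>r i. elem_sym r (i, l) * inverse Q ^ l)
        * (inverse (elem_sym r (i, r i)) * Q ^ r i)" .
    have "psi_frac n r z (inverse (elem_sym r (i, r i))) (Elt (inverse 1))"
      using e[of "r i"] z(2) by (intro psi_frac_inverse) (simp add: one_adjoin_zero_def)
    then have inv_e: "psi_frac n r z (inverse (elem_sym r (i, r i))) 1"
      by (simp add: semifield_inverse_1 one_adjoin_zero_def)
    have "psi_frac n r z (\<Prod>l=1..r i. 1 + Y (i, l))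
        ((\<Sum>l\<le>r i. z (i, l) * Elt (inverse y) ^ l) * (1 * Elt y ^ r i))"
      unfolding eq using e inv_e Q psi_frac_inverse[OF Q]
      by (intro psi_frac_mult psi_frac_sum psi_frac_power) auto
    \<comment> \<open>The factor \<open>Elt y ^ r i\<close> clears the negative powers; reversing
      the order of summation then gives the reversed polynomial at \<open>y\<close>.\<close>
    also have "(\<Sum>l\<le>r i. z (i, l) * Elt (inverse y) ^ l) * (1 * Elt y ^ r i)
        = (\<Sum>l\<le>r i. z (i, l) * Elt y ^ (r i - l))"
      unfolding sum_distrib_right
    proof (rule sum.cong[OF refl])
      fix l assume "l \<in> {..r i}"
      then have split: "Elt y ^ r i = Elt y ^ l * Elt y ^ (r i - l)" by (simp flip: power_add)
      have inv: "Elt (inverse y) ^ l * Elt y ^ l = 1"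
        by (metis Elt_mult_inverse mult.commute power_mult_distrib power_one)
      have "z (i, l) * Elt (inverse y) ^ l * (1 * Elt y ^ r i)
          = z (i, l) * (Elt (inverse y) ^ l * Elt y ^ l) * Elt y ^ (r i - l)"
        unfolding split mult_1_left by (simp only: mult_ac)
      then show "z (i, l) * Elt (inverse y) ^ l * (1 * Elt y ^ r i) = z (i, l) * Elt y ^ (r i - l)"
        unfolding inv mult_1_right .
    qed
    also have "\<dots> = (\<Sum>l\<le>r i. z (i, r i - l) * Elt y ^ l)"
      using sum.atLeastAtMost_rev[of "\<lambda>l. z (i, l) * Elt y ^ (r i - l)" 0 "r i"]
      by (simp add: atMost_atLeast0)
    also have "\<dots> = ?v" using Y by simp
    finally show ?thesis .
  qed
  moreover have "eval_P0 Z y = w" using w deg by (simp add: eval_P0_def)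
  ultimately show ?thesis using w by simp
qed

definition seed_matches ::
    "nat \<Rightarrow> (nat \<Rightarrow> nat) \<Rightarrow> (nat \<times> nat \<Rightarrow> 'p adjoin_zero) \<Rightarrow> 'p::semifield gen_seed \<Rightarrow>
     (nat \<times> nat, 'p QPs) Y_seed \<Rightarrow> bool" where
  "seed_matches n r z \<Sigma> \<Gamma> \<longleftrightarrow>
     (\<forall>d\<in>idx n r. \<forall>d'\<in>idx n r. oB \<Gamma> (d, d') = gB \<Sigma> (fst d, fst d')) \<and>
     (\<forall>i\<in>{1..n}. coeff_matches n r z (gy \<Sigma> i) (gZ \<Sigma> i) (oy \<Gamma>) i)"

lemma seed_matches_initial:
  "seed_matches n r (init_z \<Sigma>) \<Sigma> (initial_comp_seed n r \<Sigma>)"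
  unfolding seed_matches_def
proof (intro conjI ballI)
  fix d d' assume "d \<in> idx n r" "d' \<in> idx n r"
  then show "oB (initial_comp_seed n r \<Sigma>) (d, d') = gB \<Sigma> (fst d, fst d')"
    by (cases d; cases d') (simp add: initial_comp_seed_def)
next
  fix i assume "i \<in> {1..n}"
  then show "coeff_matches n r (init_z \<Sigma>) (gy \<Sigma> i) (gZ \<Sigma> i) (oy (initial_comp_seed n r \<Sigma>)) i"
    unfolding coeff_matches_def
    by (intro exI[of _ "P_to_QPs (gy \<Sigma> i)"])
      (auto simp: psi_frac_P initial_comp_seed_def idx_def init_z_def)
qed

lemma prod_power_int: "(\<Prod>x\<in>A. f x powi k) = (\<Prod>x\<in>A. f x :: 'a::field) powi k"
  by (induction A rule: infinite_finite_induct) (simp_all add: power_int_mult_distrib)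

text \<open>At \<open>k\<close>, inverting the coefficients replaces \<open>Q\<close> by its inverse
  and interchanges the two alternatives, as does reversing the exchange polynomial. Elsewhere
  \<open>Q\<close> acquires a factor whose value is the one in the generalized mutation.\<close>

lemma seed_matches_mutate:
  assumes seed: "is_gen_seed n r \<Sigma>" and k: "k \<in> {1..n}"
    and z: "\<And>i. i \<in> {1..n} \<Longrightarrow> z (i, 0) = 1" "\<And>i. i \<in> {1..n} \<Longrightarrow> z (i, r i) = 1"
    and match: "seed_matches n r z \<Sigma> \<Gamma>"
  shows "seed_matches n r z (mutate_gen n r k \<Sigma>) (mutate_comp n r k \<Gamma>)"
proof -
  let ?b = "gB \<Sigma>" and ?\<Sigma>' = "mutate_gen n r k \<Sigma>" and ?\<Gamma>' = "mutate_comp n r k \<Gamma>"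
  have B: "oB \<Gamma> (d, d') = ?b (fst d, fst d')" if "d \<in> idx n r" "d' \<in> idx n r" for d d'
    using match that unfolding seed_matches_def by blast
  have Y: "coeff_matches n r z (gy \<Sigma> i) (gZ \<Sigma> i) (oy \<Gamma>) i" if "i \<in> {1..n}" for i
    using match that unfolding seed_matches_def by blast
  have bkk: "?b (k, k) = 0"
    using seed k unfolding is_gen_seed_def by (blast intro: skew_symmetrizable_diag)
  have deg: "degree (gZ \<Sigma> k) = r k" using seed k unfolding is_gen_seed_def by blast
  note fold = fold_mutate_ord[OF k order.refl B bkk, folded mutate_comp_def, of r]
  have y': "oy ?\<Gamma>' (i, l) = (if i = k then inverse (oy \<Gamma> (k, l))
       else oy \<Gamma> (i, l) * (\<Prod>m=1..r k. oy \<Gamma> (k, m) ^ nat (max (?b (k, i)) 0)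
              * (1 + oy \<Gamma> (k, m)) powi (- ?b (k, i))))" if il: "(i, l) \<in> idx n r" for i l
    using fold il by (force simp: idx_def)
  have B': "oB ?\<Gamma>' ((i, l), (j, m)) = gB ?\<Sigma>' (i, j)"
    if il: "(i, l) \<in> idx n r" and jm: "(j, m) \<in> idx n r" for i l j m
  proof -
    have "oB ?\<Gamma>' ((i, l), (j, m)) =
      (if i = k then if l \<le> r k then - ?b (k, j) else ?b (k, j)
       else if j = k then if m \<le> r k then - ?b (i, k) else ?b (i, k)
       else ?b (i, j) + int (r k) * (?b (i, k) * max (?b (k, j)) 0 + max (- ?b (i, k)) 0 * ?b (k, j)))"
      using fold il jm by fast
    then show ?thesis
      using il jm by (auto simp: mutate_gen_def mutate_matrix_def idx_def)
  qed
  have "coeff_matches n r z (gy ?\<Sigma>' i) (gZ ?\<Sigma>' i) (oy ?\<Gamma>') i" if i: "i \<in> {1..n}" for i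
  proof (cases "i = k")
    case True
    obtain Q where Q: "psi_frac n r z Q (Elt (gy \<Sigma> k))"
      and Y: "(\<forall>l\<in>{1..r k}. oy \<Gamma> (k, l) = s_var (k, l) * Q) \<and>
          (\<forall>l\<le>r k. pi_P0 (coeff (gZ \<Sigma> k) l) = z (k, l)) \<or>
        (\<forall>l\<in>{1..r k}. oy \<Gamma> (k, l) = inverse (s_var (k, l)) * Q) \<and>
          (\<forall>l\<le>r k. pi_P0 (coeff (gZ \<Sigma> k) l) = z (k, r k - l))"
      using Y[OF k] unfolding coeff_matches_def by blast
    have "oy ?\<Gamma>' (k, l) = inverse (oy \<Gamma> (k, l))" if "l \<in> {1..r k}" for l
      using that k by (subst y') (auto simp: idx_def)
    moreover have "coeff (gZ ?\<Sigma>' k) l = coeff (gZ \<Sigma> k) (r k - l)" if "l \<le> r k" for l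
      using that k by (simp add: mutate_gen_def coeff_sum coeff_monom if_distrib sum.delta cong: if_cong)
    moreover have "gy ?\<Sigma>' k = inverse (gy \<Sigma> k)"
      using k by (simp add: mutate_gen_def mutate_y_def)
    ultimately show ?thesis
      unfolding True coeff_matches_def using psi_frac_inverse[OF Q] Y
      by (intro exI[of _ "inverse Q"]) auto
  next
    case False
    let ?N = "nat (max (?b (k, i)) 0)" and ?e = "- ?b (k, i)"
    \<comment> \<open>The common factor of all coefficients in block \<open>i\<close>; it does not
      depend on \<open>l\<close>, so the alternative that holds at \<open>i\<close> is
      preserved.\<close>
    define X where "X = (\<Prod>m=1..r k. oy \<Gamma> (k, m) ^ ?N * (1 + oy \<Gamma> (k, m)) powi ?e)"
    have X_eq: "X = (\<Prod>m=1..r k. oy \<Gamma> (k, m)) ^ ?N * (\<Prod>m=1..r k. 1 + oy \<Gamma> (k, m)) powi ?e"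
      by (simp add: X_def prod.distrib prod_power_distrib prod_power_int)
    have X: "psi_frac n r z X (Elt ((gy \<Sigma> k ^ r k) ^ ?N * eval_P0 (gZ \<Sigma> k) (gy \<Sigma> k) powi ?e))"
      unfolding X_eq
      using psi_frac_mult[OF psi_frac_power[OF coeff_matches_prod[where z = z, OF k z(1,2)[OF k] Y[OF k]], of ?N]
          psi_frac_power_int[OF coeff_matches_prod_one_plus[where z = z, OF k z(1,2)[OF k] deg Y[OF k]], of ?e]]
      by (simp add: Elt_power)
    have gy': "gy ?\<Sigma>' i = gy \<Sigma> i * ((gy \<Sigma> k ^ r k) ^ ?N * eval_P0 (gZ \<Sigma> k) (gy \<Sigma> k) powi ?e)"
      using i False by (simp add: mutate_gen_def mutate_y_def mult_ac flip: power_mult)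
    have gZ': "gZ ?\<Sigma>' i = gZ \<Sigma> i" using i False by (simp add: mutate_gen_def)
    have oy': "oy ?\<Gamma>' (i, l) = oy \<Gamma> (i, l) * X" if "l \<in> {1..r i}" for l
      unfolding X_def using that i False by (subst y') (auto simp: idx_def)
    obtain Q where Q: "psi_frac n r z Q (Elt (gy \<Sigma> i))"
      and Y: "(\<forall>l\<in>{1..r i}. oy \<Gamma> (i, l) = s_var (i, l) * Q) \<and>
          (\<forall>l\<le>r i. pi_P0 (coeff (gZ \<Sigma> i) l) = z (i, l)) \<or>
        (\<forall>l\<in>{1..r i}. oy \<Gamma> (i, l) = inverse (s_var (i, l)) * Q) \<and>
          (\<forall>l\<le>r i. pi_P0 (coeff (gZ \<Sigma> i) l) = z (i, r i - l))"
      using Y[OF i] unfolding coeff_matches_def by blast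
    have "psi_frac n r z (Q * X) (Elt (gy ?\<Sigma>' i))"
      unfolding gy' using psi_frac_mult[OF Q X] by simp
    then show ?thesis
      unfolding coeff_matches_def gZ' using Y by (intro exI[of _ "Q * X"]) (auto simp: oy')
  qed
  then show ?thesis using B' unfolding seed_matches_def by auto
qed

section \<open>Propagation along the tree and conclusion\<close>

lemma seed_matches_pattern:
  assumes tree: "labeled_regular_tree n V adj" and t: "t0 \<in> V" "t \<in> V"
    and G: "gen_Y_pattern n r V adj G" and C: "comp_Y_pattern n r adj t0 (G t0) C"
    and z: "\<And>i. i \<in> {1..n} \<Longrightarrow> z (i, 0) = 1" "\<And>i. i \<in> {1..n} \<Longrightarrow> z (i, r i) = 1"
    and init: "z = init_z (G t0)"
  shows "seed_matches n r z (G t) (C t)"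
proof -
  have step: "seed_matches n r z (G b) (C b)"
    if ab: "adj k a b" and "seed_matches n r z (G a) (C a)" for k a b
  proof -
    have "k \<in> {1..n}" "a \<in> V"
      using tree[unfolded labeled_regular_tree_def, THEN conjunct1] ab by blast+
    then have eq: "is_gen_seed n r (G a)" "G b = mutate_gen n r k (G a)" "C b = mutate_comp n r k (C a)"
      using G C ab unfolding gen_Y_pattern_def comp_Y_pattern_def by blast+
    show ?thesis
      unfolding eq(2,3) by (rule seed_matches_mutate[where z = z, OF eq(1) \<open>k \<in> {1..n}\<close> z that(2)])
  qed
  \<comment> \<open>The invariant is carried from \<open>t0\<close> along a path, with
    \<open>z\<close> kept equal to the initial data throughout.\<close>
  have path: "seed_matches n r z (G (last xs)) (C (last xs))"
    if "xs \<noteq> []" "successively (\<lambda>a b. \<exists>k. adj k a b) xs"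
      "seed_matches n r z (G (hd xs)) (C (hd xs))" for xs
    using that
  proof (induction xs rule: induct_list012)
    case (3 x y xs)
    then show ?case using step by auto
  qed auto
  obtain xs where "xs \<noteq> []" "hd xs = t0" "last xs = t" "successively (\<lambda>a b. \<exists>k. adj k a b) xs"
    using tree[unfolded labeled_regular_tree_def, THEN conjunct2, THEN conjunct2, THEN conjunct2] t
    by blast
  moreover have "seed_matches n r z (G t0) (C t0)"
    using C seed_matches_initial[of n r "G t0"] unfolding comp_Y_pattern_def init by simp
  ultimately show ?thesis using path by metis
qed

text \<open>Turns the normalization of the exchange polynomials at \<open>t0\<close> into the two
  normalizations of \<open>z\<close>.\<close>

lemma pi_P0_1: "pi_P0 1 = 1"
  using psi_ZP[OF NP_1, of undefined undefined undefined] by (simp add: psi_1)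

theorem theorem4p5:
  fixes n :: nat and r :: "nat \<Rightarrow> nat"
    and V :: "'v set" and adj :: "nat \<Rightarrow> 'v \<Rightarrow> 'v \<Rightarrow> bool" and t0 t :: 'v
    and G :: "'v \<Rightarrow> 'p::semifield gen_seed"
    and C :: "'v \<Rightarrow> (nat \<times> nat, 'p QPs) Y_seed"
    and z :: "nat \<times> nat \<Rightarrow> 'p adjoin_zero"
    and i :: nat
  assumes "n \<ge> 1" and "\<And>j. j \<in> {1..n} \<Longrightarrow> r j \<ge> 1"
    and "labeled_regular_tree n V adj" and "t0 \<in> V"
    and "gen_Y_pattern n r V adj G"
    and "comp_Y_pattern n r adj t0 (G t0) C"
    and "z = init_z (G t0)"
    and "i \<in> {1..n}" and "t \<in> V"
  shows "(\<Prod>l=1..r i. oy (C t) (i, l)) \<in> S_semi n r z \<and>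
    (\<exists>!x. is_nth_root (S_quot n r z) (r i) (S_class n r z (\<Prod>l=1..r i. oy (C t) (i, l))) x) \<and>
    S_class n r z (P_to_QPs (gy (G t) i)) =
      nth_root_in (S_quot n r z) (r i) (S_class n r z (\<Prod>l=1..r i. oy (C t) (i, l)))"
proof -
  let ?Y = "\<Prod>l=1..r i. oy (C t) (i, l)"
  have z: "z (j, 0) = 1" "z (j, r j) = 1" if "j \<in> {1..n}" for j
    using assms(4,5,7) that unfolding gen_Y_pattern_def is_gen_seed_def init_z_def
    by (auto simp: pi_P0_1)
  have "seed_matches n r z (G t) (C t)"
    by (rule seed_matches_pattern[OF assms(3,4,9,5,6) z assms(7)])
  then have "coeff_matches n r z (gy (G t) i) (gZ (G t) i) (oy (C t)) i"
    using assms(8) unfolding seed_matches_def by blast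
  then have Y: "psi_frac n r z ?Y (Elt (gy (G t) i ^ r i))"
    using coeff_matches_prod[where z = z] assms(8) z by blast
  have "r i > 0" using assms(2)[OF assms(8)] by simp
  \<comment> \<open>The product has value \<open>gy (G t) i ^ r i\<close>, and the embedded
    generalized coefficient has value \<open>gy (G t) i\<close>, so its class is the only
    root.\<close>
  note root = is_nth_root_S_quot_iff[OF Y psi_frac_P this]
  show ?thesis
    using Y unfolding S_semi_iff root nth_root_in_def by auto
qed

end
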